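(* Let $\Gamma=SL_2(\mathbb{Z})$, $\mathcal{A}$ and $\mathbf{h}\in\mathcal{M}(\mathcal{A},\Gamma)$ be as in the context. Define, for $(p,q)\in U'=\{(p,q)\in\mathbb{Z}^2:\gcd(p,q)=1,\ pq\neq0\}$, $$D_{\mathbf{h}}(p,q)=I_{\mathbf{h}}(\overrightarrow{q/p}_{\infty},\overrightarrow{\infty}_{q/p})\big|_{X=q,Y=p},\qquad F_{\mathbf{h}}(p,q)=I_{\mathbf{h}}(\overrightarrow{q/p}_{\infty},\overrightarrow{q/p}_{0})\big|_{X=q,Y=p},$$ $$E_{\mathbf{h}}(p,q)=\exp\Big(\sum_{A_i\in\mathcal{A}}A_i\,a_{\mathbf{h}(A_i)}(0)/(pq)\Big),$$ where $a_{\mathbf{h}(A_i)}(0)$ is the constant Fourier coefficient of $\mathbf{h}(A_i)$. Then $D_{\mathbf{h}}$ is a shuffled $\mathbb{C}$-valued (almost) multiple Dedekind symbol based on $\mathcal{A}$, $E_{\mathbf{h}}$ and $F_{\mathbf{h}}$ are shuffled $\mathbb{C}$-valued (almost) multiple reciprocity functions based on $\mathcal{A}$, and for all $(p,q)\in U'$ $$F_{\mathbf{h}}(p,q)=D_{\mathbf{h}}(p,q)E_{\mathbf{h}}(p,q)D_{\mathbf{h}}(-q,p)^{-1}.$$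
   Context: Setting. $\mathcal{A}=\{A_1,A_2,\dots\}$ is a set of non-commuting symbols, each $A_i$ assigned an even integer $w_i\ge2$; for a non-empty word $B=A_{i_1}\cdots A_{i_l}$ put $w(B)=w_{i_1}+\dots+w_{i_l}$; $\mathcal{B}(\mathcal{A})$ is the set of non-empty words. $\mathcal{M}_k(\Gamma)$ is the space of holomorphic modular forms of weight $k$ for $\Gamma$, and $\mathcal{M}(\mathcal{A},\Gamma)=\prod_{B\in\mathcal{B}(\mathcal{A})}\mathcal{M}_{w(B)+2}(\Gamma)$; $\mathbf{h}(B)$ denotes the $B$-component of $\mathbf{h}$. On the upper half plane $\mathfrak{h}$ put $\Omega_{\mathbf{h}}(\tau)=\sum_{B}B\,\mathbf{h}(B)(\tau)(X-Y\tau)^{w(B)}d\tau$ and $\Omega^\infty_{\mathbf{h}}(\tau)=\sum_B B\,\mathbf{h}^\infty(B)(X-Y\tau)^{w(B)}d\tau$, where $\mathbf{h}^\infty(B)$ is the constant Fourier coefficient of $\mathbf{h}(B)$ (formal forms with coefficients in power series in the words with polynomial coefficients in $X,Y$). For $\tau_0,\tau_1\in\mathfrak{h}$, $I_{\mathbf{h}}(\tau_0,\tau_1)=1+\int_{\tau_0}^{\tau_1}\Omega_{\mathbf{h}}+\int_{\tau_0}^{\tau_1}\Omega_{\mathbf{h}}\Omega_{\mathbf{h}}+\cdots$ is the (path-independent) iterated integral, with the convention that $\frac{d}{d\tau}I_{\mathbf{h}}(\tau,\tau_1)=-\Omega_{\mathbf{h}}(\tau)I_{\mathbf{h}}(\tau,\tau_1)$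 (as a form in $\tau$) and $I_{\mathbf{h}}(\tau_0,\tau_1)I_{\mathbf{h}}(\tau_1,\tau_2)=I_{\mathbf{h}}(\tau_0,\tau_2)$; $I^\infty_{\mathbf{h}}$ is defined likewise from $\Omega^\infty_{\mathbf{h}}$, and since its coefficients are polynomial it also makes sense with a rational endpoint. For $\tau\in\mathfrak{h}$ and $s\in\mathbb{Q}$ (or $s$ any point of $\mathbb{P}^1(\mathbb{Q})$ where meaningful), the regularized integral to the tangential base point $\overrightarrow{s}_\infty$ is $I_{\mathbf{h}}(\tau,\overrightarrow{s}_\infty)=\lim_{\varepsilon\to i\infty}I_{\mathbf{h}}(\tau,\varepsilon)I^\infty_{\mathbf{h}}(\varepsilon,s)$ (the limit exists), and $I_{\mathbf{h}}(\overrightarrow{s}_\infty,\tau)=I_{\mathbf{h}}(\tau,\overrightarrow{s}_\infty)^{-1}$. $\Gamma$ acts on polynomials by $P(X,Y)|_\gamma=P(aX+bY,cX+dY)$ for $\gamma=\begin{pmatrix}a&b\\c&d\end{pmatrix}$, extended coefficientwise, and on $\mathbb{P}^1(\mathbb{Q})\cup\mathfrak{h}$ by Möbius transformations. For a cusp $r\in\mathbb{Q}$, $\tau_1\in\mathfrak{h}$ and $\gamma\in\Gamma$ with $\gamma(\infty)=r$: $I_{\mathbf{h}}(\overrightarrow{s}_r,\tau_1)=I_{\mathbf{h}}(\overrightarrow{\gamma^{-1}(s)}_\infty,\gamma^{-1}(\tau_1))|_\gamma$, and $I_{\mathbf{h}}(\tau_1,\overrightarrow{s}_r)=I_{\mathbf{h}}(\overrightarrow{s}_r,\tau_1)^{-1}$.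 Finally $I_{\mathbf{h}}(\overrightarrow{s}_{r_0},\overrightarrow{t}_{r_2})=I_{\mathbf{h}}(\overrightarrow{s}_{r_0},\tau_1)I_{\mathbf{h}}(\tau_1,\overrightarrow{t}_{r_2})$ for any $\tau_1\in\mathfrak{h}$ (independent of $\tau_1$). Substituting $X=q$, $Y=p$ yields functions on $U'$ with values in $\mathbb{C}\langle\langle\mathcal{A}\rangle\rangle^\times$ (non-commutative formal power series in $\mathcal{A}$ with complex coefficients). Definitions: a $\mathbb{C}$-valued almost multiple Dedekind symbol based on $\mathcal{A}$ is $D:U'\to\mathbb{C}\langle\langle\mathcal{A}\rangle\rangle^\times$ of the form $1+\sum_{w\neq\emptyset}D^w(p,q)w$ with $D(p,q)=D(p,p+q)$ whenever $p,q,p+q\neq0$ and $D(p,-q)=D(-p,q)$; a $\mathbb{C}$-valued almost multiple reciprocity function is $F:U'\to\mathbb{C}\langle\langle\mathcal{A}\rangle\rangle^\times$ of the same form with $F(p,q)=F(p,p+q)F(p+q,q)$ whenever $p,q,p+q\neq0$, $F(p,q)F(-q,p)=1$ and $F(p,-q)=F(-p,q)$. Such a function is shuffled if its components satisfy $D^u D^v=\sum_{w\in Sh(u,v)}D^w$ pointwise for all words $u,v$ (with $D^\emptyset=1$), where $Sh(u,v)$ is the multiset of shuffles of $u$ and $v$ counted with multiplicity.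
   Formalization: Integrals at a cusp r=γ(∞) are slashed with γ⁻¹, not γ (else ill-defined). D and F are shuffled only if the sums of h(w) over Sh(u,v) vanish for non-empty u,v; F=DED⁻¹ only if h(B) has zero constant term for all words of length ≥2. Both fail for general h. *)

theory Defs
  imports "HOL-Complex_Analysis.Complex_Analysis" "HOL-Library.Multiset"
begin

section \<open>Non-commutative formal power series\<close>

typedef 'a ncps = "UNIV :: ('a list \<Rightarrow> complex) set"
  morphisms nc_coeff NC
  by simp

lemma nc_coeff_NC [simp]: "nc_coeff (NC f) = f"
  by (simp add: NC_inverse)

lemma ncps_eqI: "(\<And>w. nc_coeff f w = nc_coeff g w) \<Longrightarrow> f = g"
  by (metis ext nc_coeff_inject)

instantiation ncps :: (type) ring_1
begin

definition "0 = NC (\<lambda>w. 0)"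
definition "1 = NC (\<lambda>w. if w = [] then 1 else 0)"
definition "f + g = NC (\<lambda>w. nc_coeff f w + nc_coeff g w)"
definition "- f = NC (\<lambda>w. - nc_coeff f w)"
definition "f - g = NC (\<lambda>w. nc_coeff f w - nc_coeff g w)"
definition "f * g = NC (\<lambda>w. \<Sum>k\<le>length w. nc_coeff f (take k w) * nc_coeff g (drop k w))"

instance
proof
  fix a b c :: "'a ncps"
  show "a * b * c = a * (b * c)"
  proof (rule ncps_eqI)
    fix w :: "'a list"
    let ?n = "length w"
    let ?f = "\<lambda>i j (k::nat). nc_coeff a (take i w) * nc_coeff b (take j (drop i w)) * nc_coeff c (drop (i + j) w)"
    have "nc_coeff (a * b * c) w = (\<Sum>j=0..?n. \<Sum>i=0..j. ?f i (j - i) (?n - j))"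
      unfolding times_ncps_def
      by (auto simp: sum_distrib_right atLeast0AtMost drop_take min_def intro!: sum.cong)
    also have "\<dots> = (\<Sum>j=0..?n. \<Sum>i=0..?n - j. ?f j i (?n - j - i))"
      by (rule fps_mult_assoc_lemma)
    also have "\<dots> = nc_coeff (a * (b * c)) w"
      by (simp add: times_ncps_def sum_distrib_left atLeast0AtMost mult.assoc add.commute)
    finally show "nc_coeff (a * b * c) w = nc_coeff (a * (b * c)) w" .
  qed
  show "1 * a = a"
  proof (rule ncps_eqI)
    fix w :: "'a list"
    have "nc_coeff (1 * a) w = (\<Sum>k\<le>length w. if k = 0 then nc_coeff a w else 0)"
      unfolding times_ncps_def one_ncps_def nc_coeff_NC by (rule sum.cong) auto
    then show "nc_coeff (1 * a) w = nc_coeff a w"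
      by simp
  qed
  show "a * 1 = a"
  proof (rule ncps_eqI)
    fix w :: "'a list"
    have "nc_coeff (a * 1) w = (\<Sum>k\<le>length w. if k = length w then nc_coeff a w else 0)"
      unfolding times_ncps_def one_ncps_def nc_coeff_NC by (rule sum.cong) auto
    then show "nc_coeff (a * 1) w = nc_coeff a w"
      by simp
  qed
  show "(0 :: 'a ncps) \<noteq> 1"
  proof
    assume "(0 :: 'a ncps) = 1"
    then have "nc_coeff (0 :: 'a ncps) [] = nc_coeff 1 []"
      by simp
    then show False
      by (simp add: zero_ncps_def one_ncps_def)
  qed
qed (auto intro!: ncps_eqI simp: zero_ncps_def plus_ncps_def uminus_ncps_def minus_ncps_def
       times_ncps_def sum.distrib algebra_simps)

end

definition nc_inverse :: "'a ncps \<Rightarrow> 'a ncps" where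
  "nc_inverse f = (THE g. f * g = 1 \<and> g * f = 1)"

definition nc_exp :: "'a ncps \<Rightarrow> 'a ncps" where
  "nc_exp f = NC (\<lambda>w. \<Sum>n. nc_coeff (f ^ n) w / fact n)"

text \<open>Shuffles counted with multiplicity; the library's \<open>shuffles\<close> is only the underlying set.\<close>

fun mshuffles :: "'a list \<Rightarrow> 'a list \<Rightarrow> 'a list multiset" where
  "mshuffles [] ys = {#ys#}"
| "mshuffles (x # xs) [] = {#x # xs#}"
| "mshuffles (x # xs) (y # ys) =
     image_mset ((#) x) (mshuffles xs (y # ys)) + image_mset ((#) y) (mshuffles (x # xs) ys)"


section \<open>Dedekind symbols and reciprocity functions\<close>

definition U' :: "(int \<times> int) set" where
  "U' = {(p, q). gcd p q = 1 \<and> p * q \<noteq> 0}"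

text \<open>Functions on \<open>U'\<close> are total functions whose values outside \<open>U'\<close> are irrelevant.\<close>

definition almost_multiple_dedekind_symbol :: "(int \<Rightarrow> int \<Rightarrow> 'a ncps) \<Rightarrow> bool" where
  "almost_multiple_dedekind_symbol D \<longleftrightarrow>
     (\<forall>(p, q)\<in>U'. nc_coeff (D p q) [] = 1) \<and>
     (\<forall>(p, q)\<in>U'. p + q \<noteq> 0 \<longrightarrow> D p q = D p (p + q)) \<and>
     (\<forall>(p, q)\<in>U'. D p (- q) = D (- p) q)"

definition almost_multiple_reciprocity_function :: "(int \<Rightarrow> int \<Rightarrow> 'a ncps) \<Rightarrow> bool" where
  "almost_multiple_reciprocity_function F \<longleftrightarrow>
     (\<forall>(p, q)\<in>U'. nc_coeff (F p q) [] = 1) \<and>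
     (\<forall>(p, q)\<in>U'. p + q \<noteq> 0 \<longrightarrow> F p q = F p (p + q) * F (p + q) q) \<and>
     (\<forall>(p, q)\<in>U'. F p q * F (- q) p = 1) \<and>
     (\<forall>(p, q)\<in>U'. F p (- q) = F (- p) q)"

definition shuffled :: "(int \<Rightarrow> int \<Rightarrow> 'a ncps) \<Rightarrow> bool" where
  "shuffled D \<longleftrightarrow>
     (\<forall>(p, q)\<in>U'. \<forall>u v. nc_coeff (D p q) u * nc_coeff (D p q) v =
        (\<Sum>w\<in>#mshuffles u v. nc_coeff (D p q) w))"


section \<open>Modular forms for the full modular group\<close>

definition uhp :: "complex set" where
  "uhp = {\<tau>. Im \<tau> > 0}"

definition SL2Z :: "(int ^ 2 ^ 2) set" where
  "SL2Z = {\<gamma>. det \<gamma> = 1}"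

definition moebius :: "int ^ 2 ^ 2 \<Rightarrow> complex \<Rightarrow> complex" where
  "moebius \<gamma> \<tau> = (of_int (\<gamma> $ 1 $ 1) * \<tau> + of_int (\<gamma> $ 1 $ 2)) /
                  (of_int (\<gamma> $ 2 $ 1) * \<tau> + of_int (\<gamma> $ 2 $ 2))"

definition has_fourier_expansion :: "(complex \<Rightarrow> complex) \<Rightarrow> (nat \<Rightarrow> complex) \<Rightarrow> bool" where
  "has_fourier_expansion f a \<longleftrightarrow>
     (\<forall>\<tau>\<in>uhp. (\<lambda>n. a n * exp (2 * of_real pi * \<i> * of_nat n * \<tau>)) sums f \<tau>)"

definition fourier_coeff :: "(complex \<Rightarrow> complex) \<Rightarrow> nat \<Rightarrow> complex" where
  "fourier_coeff f = (THE a. has_fourier_expansion f a)"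

definition modular_form :: "nat \<Rightarrow> (complex \<Rightarrow> complex) \<Rightarrow> bool" where
  "modular_form k f \<longleftrightarrow>
     f holomorphic_on uhp \<and>
     (\<forall>\<gamma>\<in>SL2Z. \<forall>\<tau>\<in>uhp.
        f (moebius \<gamma> \<tau>) = (of_int (\<gamma> $ 2 $ 1) * \<tau> + of_int (\<gamma> $ 2 $ 2)) ^ k * f \<tau>) \<and>
     (\<exists>a. has_fourier_expansion f a)"

definition word_weight :: "('a \<Rightarrow> nat) \<Rightarrow> 'a list \<Rightarrow> nat" where
  "word_weight wt B = sum_list (map wt B)"

text \<open>The product of the spaces of modular forms of weight \<open>w(B) + 2\<close> over all non-empty words \<open>B\<close>;
  the value of a family at the empty word is never used.\<close>

definition modular_families :: "('a \<Rightarrow> nat) \<Rightarrow> ('a list \<Rightarrow> complex \<Rightarrow> complex) set" where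
  "modular_families wt = {h. \<forall>B. B \<noteq> [] \<longrightarrow> modular_form (word_weight wt B + 2) (h B)}"


section \<open>Iterated integrals\<close>

text \<open>Polynomials in \<open>X, Y\<close> over the complex numbers are represented by the corresponding
  polynomial functions, so a series with polynomial coefficients becomes a function
  \<open>complex \<Rightarrow> complex \<Rightarrow> 'a ncps\<close> of \<open>X\<close> and \<open>Y\<close>, and all operations are pointwise in \<open>X, Y\<close>.\<close>

definition slash :: "(complex \<Rightarrow> complex \<Rightarrow> 'b) \<Rightarrow> int ^ 2 ^ 2 \<Rightarrow> complex \<Rightarrow> complex \<Rightarrow> 'b" where
  "slash P \<gamma> = (\<lambda>X Y. P (of_int (\<gamma> $ 1 $ 1) * X + of_int (\<gamma> $ 1 $ 2) * Y)
                        (of_int (\<gamma> $ 2 $ 1) * X + of_int (\<gamma> $ 2 $ 2) * Y))"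

definition Omega ::
  "('a \<Rightarrow> nat) \<Rightarrow> ('a list \<Rightarrow> complex \<Rightarrow> complex) \<Rightarrow> complex \<Rightarrow> complex \<Rightarrow> complex \<Rightarrow> 'a ncps" where
  "Omega wt h X Y \<tau> = NC (\<lambda>B. if B = [] then 0 else h B \<tau> * (X - Y * \<tau>) ^ word_weight wt B)"

definition Omega_inf ::
  "('a \<Rightarrow> nat) \<Rightarrow> ('a list \<Rightarrow> complex \<Rightarrow> complex) \<Rightarrow> complex \<Rightarrow> complex \<Rightarrow> complex \<Rightarrow> 'a ncps" where
  "Omega_inf wt h X Y \<tau> =
     NC (\<lambda>B. if B = [] then 0 else fourier_coeff (h B) 0 * (X - Y * \<tau>) ^ word_weight wt B)"

text \<open>The \<open>n\<close>-fold iterated integral from \<open>\<tau>\<^sub>0\<close> to \<open>\<tau>\<^sub>1\<close> along the segment. The leftmost factor belongs to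
  the point nearest to \<open>\<tau>\<^sub>0\<close>, which gives \<open>dI(\<tau>, \<tau>\<^sub>1) = - \<Omega>(\<tau>) I(\<tau>, \<tau>\<^sub>1)\<close>.\<close>

primrec iter_int_n ::
  "(complex \<Rightarrow> 'a ncps) \<Rightarrow> nat \<Rightarrow> complex \<Rightarrow> complex \<Rightarrow> 'a ncps" where
  "iter_int_n \<Omega> 0 = (\<lambda>\<tau>\<^sub>0 \<tau>\<^sub>1. 1)"
| "iter_int_n \<Omega> (Suc n) = (\<lambda>\<tau>\<^sub>0 \<tau>\<^sub>1.
     NC (\<lambda>w. contour_integral (linepath \<tau>\<^sub>0 \<tau>\<^sub>1) (\<lambda>t. nc_coeff (\<Omega> t * iter_int_n \<Omega> n t \<tau>\<^sub>1) w)))"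

definition iter_int :: "(complex \<Rightarrow> 'a ncps) \<Rightarrow> complex \<Rightarrow> complex \<Rightarrow> 'a ncps" where
  "iter_int \<Omega> \<tau>\<^sub>0 \<tau>\<^sub>1 = NC (\<lambda>w. \<Sum>n. nc_coeff (iter_int_n \<Omega> n \<tau>\<^sub>0 \<tau>\<^sub>1) w)"

datatype cusp = Infty | Fin rat

definition cusp_moebius :: "int ^ 2 ^ 2 \<Rightarrow> cusp \<Rightarrow> cusp" where
  "cusp_moebius \<gamma> s = (case s of
      Infty \<Rightarrow> (if \<gamma> $ 2 $ 1 = 0 then Infty else Fin (of_int (\<gamma> $ 1 $ 1) / of_int (\<gamma> $ 2 $ 1)))
    | Fin s \<Rightarrow>
       (let d = of_int (\<gamma> $ 2 $ 1) * s + of_int (\<gamma> $ 2 $ 2)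
        in if d = 0 then Infty else Fin ((of_int (\<gamma> $ 1 $ 1) * s + of_int (\<gamma> $ 1 $ 2)) / d)))"

text \<open>\<open>int_to_inf wt h \<tau> s\<close> is the regularized integral from \<open>\<tau>\<close> to the base point \<open>s\<close> at infinity,
  where \<open>\<epsilon> = \<i>y\<close> with \<open>y \<rightarrow> \<infinity>\<close>; it is meaningless for \<open>s = \<infinity>\<close>.\<close>

definition int_to_inf ::
  "('a \<Rightarrow> nat) \<Rightarrow> ('a list \<Rightarrow> complex \<Rightarrow> complex) \<Rightarrow> complex \<Rightarrow> cusp \<Rightarrow> complex \<Rightarrow> complex \<Rightarrow> 'a ncps"
where
  "int_to_inf wt h \<tau> s X Y = (case s of
      Infty \<Rightarrow> undefined
    | Fin s \<Rightarrow> NC (\<lambda>w. Lim at_top (\<lambda>y::real.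
        nc_coeff (iter_int (Omega wt h X Y) \<tau> (\<i> * of_real y) *
                  iter_int (Omega_inf wt h X Y) (\<i> * of_real y) (of_rat s)) w)))"

definition int_from_inf ::
  "('a \<Rightarrow> nat) \<Rightarrow> ('a list \<Rightarrow> complex \<Rightarrow> complex) \<Rightarrow> cusp \<Rightarrow> complex \<Rightarrow> complex \<Rightarrow> complex \<Rightarrow> 'a ncps"
where
  "int_from_inf wt h s \<tau> X Y = nc_inverse (int_to_inf wt h \<tau> s X Y)"

text \<open>\<open>int_from_tan wt h s r \<tau>\<close> and \<open>int_to_tan wt h \<tau> s r\<close> are the integrals from, respectively to, the
  base point \<open>s\<close> at the cusp \<open>r\<close>. At a finite cusp \<open>r = \<gamma>(\<infinity>)\<close> one transports by \<open>\<gamma>\<close>: since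
  \<open>\<Omega>(\<gamma>\<tau>)\<close> slashed with \<open>\<gamma>\<close> equals \<open>\<Omega>(\<tau>)\<close>, the value must be slashed with the inverse of \<open>\<gamma>\<close>; only then is it
  independent of \<open>\<gamma>\<close>. The definite description denotes the value common to all admissible \<open>\<gamma>\<close>.\<close>

definition int_from_tan ::
  "('a \<Rightarrow> nat) \<Rightarrow> ('a list \<Rightarrow> complex \<Rightarrow> complex) \<Rightarrow> cusp \<Rightarrow> cusp \<Rightarrow> complex \<Rightarrow>
   complex \<Rightarrow> complex \<Rightarrow> 'a ncps"
where
  "int_from_tan wt h s r \<tau> = (case r of
      Infty \<Rightarrow> int_from_inf wt h s \<tau>
    | Fin _ \<Rightarrow> (THE J. \<forall>\<gamma>\<in>SL2Z. cusp_moebius \<gamma> Infty = r \<longrightarrow>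
        J = slash (int_from_inf wt h (cusp_moebius (matrix_inv \<gamma>) s) (moebius (matrix_inv \<gamma>) \<tau>))
              (matrix_inv \<gamma>)))"

definition int_to_tan ::
  "('a \<Rightarrow> nat) \<Rightarrow> ('a list \<Rightarrow> complex \<Rightarrow> complex) \<Rightarrow> complex \<Rightarrow> cusp \<Rightarrow> cusp \<Rightarrow>
   complex \<Rightarrow> complex \<Rightarrow> 'a ncps"
where
  "int_to_tan wt h \<tau> s r = (case r of
      Infty \<Rightarrow> int_to_inf wt h \<tau> s
    | Fin _ \<Rightarrow> (\<lambda>X Y. nc_inverse (int_from_tan wt h s r \<tau> X Y)))"

text \<open>The value of \<open>I(s\<^bsub>r\<^esub>, \<tau>) I(\<tau>, s'\<^bsub>r'\<^esub>)\<close> common to all \<open>\<tau>\<close> in the upper half plane.\<close>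

definition int_tan_tan ::
  "('a \<Rightarrow> nat) \<Rightarrow> ('a list \<Rightarrow> complex \<Rightarrow> complex) \<Rightarrow> cusp \<Rightarrow> cusp \<Rightarrow> cusp \<Rightarrow> cusp \<Rightarrow>
   complex \<Rightarrow> complex \<Rightarrow> 'a ncps"
where
  "int_tan_tan wt h s r s' r' = (THE J. \<forall>\<tau>\<in>uhp.
     J = (\<lambda>X Y. int_from_tan wt h s r \<tau> X Y * int_to_tan wt h \<tau> s' r' X Y))"


section \<open>The functions attached to a family of modular forms\<close>

definition dedekind_D ::
  "('a \<Rightarrow> nat) \<Rightarrow> ('a list \<Rightarrow> complex \<Rightarrow> complex) \<Rightarrow> int \<Rightarrow> int \<Rightarrow> 'a ncps" where
  "dedekind_D wt h p q =
     (let s = Fin (of_int q / of_int p)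
      in int_tan_tan wt h s Infty Infty s (of_int q) (of_int p))"

definition reciprocity_F ::
  "('a \<Rightarrow> nat) \<Rightarrow> ('a list \<Rightarrow> complex \<Rightarrow> complex) \<Rightarrow> int \<Rightarrow> int \<Rightarrow> 'a ncps" where
  "reciprocity_F wt h p q =
     (let s = Fin (of_int q / of_int p)
      in int_tan_tan wt h s Infty s (Fin 0) (of_int q) (of_int p))"

definition reciprocity_E :: "('a list \<Rightarrow> complex \<Rightarrow> complex) \<Rightarrow> int \<Rightarrow> int \<Rightarrow> 'a ncps" where
  "reciprocity_E h p q =
     nc_exp (NC (\<lambda>w. if length w = 1 then fourier_coeff (h w) 0 / of_int (p * q) else 0))"

text \<open>Since \<open>\<Omega>\<close> has terms at words of length at least two, its iterated integrals satisfy the shuffle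
  relations only if its values are Lie series, that is, if the components of \<open>h\<close> over the shuffles of two
  non-empty words sum to zero. This and \<open>letter_constant_terms\<close> hold in particular if \<open>h B = 0\<close> for all
  words \<open>B\<close> of length at least two.\<close>

definition lie_family :: "('a list \<Rightarrow> complex \<Rightarrow> complex) \<Rightarrow> bool" where
  "lie_family h \<longleftrightarrow> (\<forall>u v. u \<noteq> [] \<longrightarrow> v \<noteq> [] \<longrightarrow> (\<forall>\<tau>\<in>uhp. (\<Sum>w\<in>#mshuffles u v. h w \<tau>) = 0))"

text \<open>For an arbitrary family the middle factor of the factorization of \<open>F\<close> is the exponential of
  the sum of \<open>B a(B) / (p q)\<close> over all words \<open>B\<close>, with \<open>a(B)\<close> the constant coefficient of \<open>h B\<close>; it is
  \<open>reciprocity_E\<close> exactly under the following condition.\<close>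

definition letter_constant_terms :: "('a list \<Rightarrow> complex \<Rightarrow> complex) \<Rightarrow> bool" where
  "letter_constant_terms h \<longleftrightarrow> (\<forall>B. length B \<ge> 2 \<longrightarrow> fourier_coeff (h B) 0 = 0)"

end

theory Submission
  imports Defs "HOL-Real_Asymp.Real_Asymp"
begin

no_notation fps_nth (infixl "$" 75)

text \<open>
  The iterated integral \<open>I(\<tau>, \<tau>\<^sub>1)\<close> is the unique solution of \<open>F' = - \<Omega> F\<close> with value \<open>1\<close> at \<open>\<tau>\<^sub>1\<close>; uniqueness
  follows coefficient by coefficient because \<open>\<Omega>\<close> has no constant term. It yields the composition
  of paths, the invariance under \<open>\<tau> \<mapsto> \<gamma>\<tau>\<close>, \<open>(X, Y) \<mapsto> \<gamma>(X, Y)\<close>, and the shuffle relations when \<open>\<Omega>\<close> is Lie-valued.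

  The product \<open>K(\<epsilon>) = I(\<tau>, \<epsilon>) I\<^sup>\<infinity>(\<epsilon>, s)\<close> satisfies \<open>K' = K G\<close> with
  \<open>G = I\<^sup>\<infinity>(s, \<epsilon>) (\<Omega> - \<Omega>\<^sup>\<infinity>) I\<^sup>\<infinity>(\<epsilon>, s)\<close> decaying exponentially, so \<open>K\<close> converges, uniformly in vertical half-strips.
  Hence the regularized integrals are compatible with translations, and the integrals between
  tangential base points are well defined, composable and \<open>SL\<^sub>2(\<int>)\<close>-equivariant.

  The functional equations of \<open>D\<close> and \<open>F\<close> are equivariance under \<open>1 1; 0 1\<close>, \<open>1 0; 1 1\<close> and \<open>0 -1; 1 0\<close> followed by
  composition of paths. With \<open>s = q/p\<close>, the path from \<open>\<infinity>\<close> to \<open>0\<close> is decomposed through the cusp \<open>s\<close>. The middle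
  piece, from the base point \<open>\<infinity>\<close> to the base point \<open>0\<close> at \<open>s\<close>, becomes at infinity an integral of \<open>\<Omega>\<^sup>\<infinity>\<close>
  at \<open>(X, Y) = (1, 0)\<close> over a segment of length \<open>1/(pq)\<close>, which is \<open>E(p, q)\<close>.
\<close>

section \<open>Non-commutative power series and shuffles\<close>

lemma nc_coeff_zero [simp]: "nc_coeff 0 w = 0"
  by (simp add: zero_ncps_def)

lemma nc_coeff_one: "nc_coeff 1 w = (if w = [] then 1 else 0)"
  by (simp add: one_ncps_def)

lemma nc_coeff_add [simp]: "nc_coeff (f + g) w = nc_coeff f w + nc_coeff g w"
  by (simp add: plus_ncps_def)

lemma nc_coeff_uminus [simp]: "nc_coeff (- f) w = - nc_coeff f w"
  by (simp add: uminus_ncps_def)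

lemma nc_coeff_diff [simp]: "nc_coeff (f - g) w = nc_coeff f w - nc_coeff g w"
  by (simp add: minus_ncps_def)

lemma nc_coeff_mult:
  "nc_coeff (f * g) w = (\<Sum>k\<le>length w. nc_coeff f (take k w) * nc_coeff g (drop k w))"
  by (simp add: times_ncps_def)

lemma nc_coeff_mult_Nil [simp]: "nc_coeff (f * g) [] = nc_coeff f [] * nc_coeff g []"
  by (simp add: nc_coeff_mult)

lemma nc_coeff_mult_split_left:
  "nc_coeff (f * g) w = nc_coeff f [] * nc_coeff g w +
     (\<Sum>k\<in>{1..length w}. nc_coeff f (take k w) * nc_coeff g (drop k w))"
proof -
  have "{..length w} = insert 0 {1..length w}"
    by auto
  then show ?thesis
    by (simp add: nc_coeff_mult)
qed

lemma nc_coeff_mult_split_right: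
  "nc_coeff (f * g) w = (\<Sum>k<length w. nc_coeff f (take k w) * nc_coeff g (drop k w)) +
     nc_coeff f w * nc_coeff g []"
  by (simp add: nc_coeff_mult lessThan_Suc_atMost [symmetric])

section \<open>Inverses of series with constant term 1\<close>

function nc_rinv_coeff :: "('a list \<Rightarrow> complex) \<Rightarrow> 'a list \<Rightarrow> complex" where
  "nc_rinv_coeff f w = (if w = [] then 1
     else - (\<Sum>k\<in>{1..length w}. f (take k w) * nc_rinv_coeff f (drop k w)))"
  by auto
termination
  by (relation "Wellfounded.measure (length \<circ> snd)") auto

declare nc_rinv_coeff.simps [simp del]

text \<open>With constant term 1, the equation \<open>f * g = 1\<close> at a word \<open>w\<close>
  can be solved for the coefficient of \<open>g\<close> at \<open>w\<close> in terms of proper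
  suffixes of \<open>w\<close>; \<open>nc_rinv_coeff\<close> is this recursion.\<close>

lemma nc_right_inverse_exists:
  assumes "nc_coeff f [] = 1"
  shows "\<exists>g. f * g = 1 \<and> nc_coeff g [] = 1"
proof (intro exI conjI)
  let ?g = "NC (nc_rinv_coeff (nc_coeff f))"
  show "f * ?g = 1"
  proof (rule ncps_eqI)
    fix w :: "'a list"
    show "nc_coeff (f * ?g) w = nc_coeff 1 w"
    proof (cases "w = []")
      case True
      then show ?thesis
        by (simp add: assms nc_coeff_one nc_rinv_coeff.simps)
    next
      case False
      then show ?thesis
        using nc_rinv_coeff.simps [of "nc_coeff f" w]
        by (simp add: nc_coeff_mult_split_left nc_coeff_one assms)
    qed
  qed
  show "nc_coeff ?g [] = 1"
    by (simp add: nc_rinv_coeff.simps)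
qed

lemma nc_inverse_unique:
  assumes "f * g = 1" "g * f = 1"
  shows "nc_inverse f = g"
  unfolding nc_inverse_def
proof (rule the_equality)
  show "f * g = 1 \<and> g * f = 1"
    using assms by simp
next
  fix k
  assume k: "f * k = 1 \<and> k * f = 1"
  then have "k = k * (f * g)"
    using assms by simp
  also have "\<dots> = g"
    using k by (simp add: mult.assoc [symmetric])
  finally show "k = g" .
qed

text \<open>A right inverse \<open>g\<close> again has constant term 1, hence a right inverse
  \<open>k\<close> of its own. Associativity gives \<open>k = f\<close>, so \<open>g\<close> is
  two-sided.\<close>

lemma nc_inverse:
  assumes "nc_coeff f [] = 1"
  shows nc_right_inverse: "f * nc_inverse f = 1"
    and nc_left_inverse: "nc_inverse f * f = 1"
    and nc_coeff_inverse_Nil: "nc_coeff (nc_inverse f) [] = 1"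
proof -
  obtain g where g: "f * g = 1" "nc_coeff g [] = 1"
    using nc_right_inverse_exists [OF assms] by blast
  obtain k where k: "g * k = 1"
    using nc_right_inverse_exists [OF g(2)] by blast
  have "k = f * g * k"
    using g by simp
  then have "k = f"
    using k by (simp add: mult.assoc)
  then have "nc_inverse f = g"
    using g k by (intro nc_inverse_unique) auto
  then show "f * nc_inverse f = 1" "nc_inverse f * f = 1" "nc_coeff (nc_inverse f) [] = 1"
    using g k \<open>k = f\<close> by auto
qed

lemma nc_inverse_mult:
  assumes "nc_coeff f [] = 1" "nc_coeff g [] = 1"
  shows "nc_inverse (f * g) = nc_inverse g * nc_inverse f"
proof (rule nc_inverse_unique)
  have "f * g * (nc_inverse g * nc_inverse f) = f * (g * nc_inverse g) * nc_inverse f"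
    by (simp add: mult.assoc)
  then show "f * g * (nc_inverse g * nc_inverse f) = 1"
    using assms by (simp add: nc_right_inverse)
  have "nc_inverse g * nc_inverse f * (f * g) = nc_inverse g * (nc_inverse f * f) * g"
    by (simp add: mult.assoc)
  then show "nc_inverse g * nc_inverse f * (f * g) = 1"
    using assms by (simp add: nc_left_inverse)
qed

lemma nc_inverse_inverse:
  assumes "nc_coeff f [] = 1"
  shows "nc_inverse (nc_inverse f) = f"
  using assms by (intro nc_inverse_unique nc_left_inverse nc_right_inverse)

section \<open>Shuffle products, group-like series and Lie series\<close>

lemma mshuffles_Nil_right [simp]: "mshuffles u [] = {#u#}"
  by (cases u) auto

text \<open>Deconcatenation is multiplicative for the shuffle product.\<close>

lemma sum_mshuffles_deconcat:
  fixes \<phi> :: "'a list \<Rightarrow> 'a list \<Rightarrow> complex"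
  shows "(\<Sum>w\<in>#mshuffles u v. \<Sum>k\<le>length w. \<phi> (take k w) (drop k w)) =
    (\<Sum>i\<le>length u. \<Sum>j\<le>length v. \<Sum>a\<in>#mshuffles (take i u) (take j v).
       \<Sum>b\<in>#mshuffles (drop i u) (drop j v). \<phi> a b)"
proof (induction u v arbitrary: \<phi> rule: mshuffles.induct)
  case (1 ys)
  then show ?case by simp
next
  case (2 x xs)
  show ?case
    by (simp del: mshuffles.simps)
next
  case (3 x xs y ys)
  let ?u = "x # xs" and ?v = "y # ys"
  \<comment> \<open>\<open>R i j\<close> is the summand for prefixes of lengths \<open>i\<close> and
    \<open>j\<close>. \<open>A\<close> and \<open>B\<close> are the parts in which the shuffled
    prefix begins with \<open>x\<close> and with \<open>y\<close>; the shuffle recursion on the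
    prefixes then gives the three equations for \<open>R\<close>.\<close>
  define R where "R i j = (\<Sum>a\<in>#mshuffles (take i ?u) (take j ?v).
       \<Sum>b\<in>#mshuffles (drop i ?u) (drop j ?v). \<phi> a b)" for i j
  define A where "A i j = (\<Sum>a\<in>#mshuffles (take i xs) (take j ?v).
       \<Sum>b\<in>#mshuffles (drop i xs) (drop j ?v). \<phi> (x # a) b)" for i j
  define B where "B i j = (\<Sum>a\<in>#mshuffles (take i ?u) (take j ys).
       \<Sum>b\<in>#mshuffles (drop i ?u) (drop j ys). \<phi> (y # a) b)" for i j
  have R: "R (Suc i) 0 = A i 0" "R 0 (Suc j) = B 0 j"
    "R (Suc i) (Suc j) = A i (Suc j) + B (Suc i) j" for i j
    by (simp_all add: R_def A_def B_def image_mset.compositionality o_def)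
  \<comment> \<open>The cut \<open>k = 0\<close> is split off; for every other cut the left word
    contains the first letter of the shuffle, which is \<open>x\<close> or \<open>y\<close>.\<close>
  have "(\<Sum>w\<in>#mshuffles ?u ?v. \<Sum>k\<le>length w. \<phi> (take k w) (drop k w)) =
     (\<Sum>w\<in>#mshuffles ?u ?v. \<phi> [] w) +
     (\<Sum>w\<in>#mshuffles xs ?v. \<Sum>k\<le>length w. \<phi> (x # take k w) (drop k w)) +
     (\<Sum>w\<in>#mshuffles ?u ys. \<Sum>k\<le>length w. \<phi> (y # take k w) (drop k w))"
    by (simp add: image_mset.compositionality o_def sum.atMost_Suc_shift sum_mset.distrib
          algebra_simps del: sum.atMost_Suc)
  also have "\<dots> = R 0 0 + (\<Sum>i\<le>length xs. \<Sum>j\<le>length ?v. A i j) +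
      (\<Sum>i\<le>length ?u. \<Sum>j\<le>length ys. B i j)"
    using "3.IH"(1) [of "\<lambda>a. \<phi> (x # a)"] "3.IH"(2) [of "\<lambda>a. \<phi> (y # a)"]
    by (simp add: R_def A_def B_def)
  also have "\<dots> = (\<Sum>i\<le>length ?u. \<Sum>j\<le>length ?v. R i j)"
    by (simp add: sum.atMost_Suc_shift sum.distrib R algebra_simps del: sum.atMost_Suc)
  finally show ?case
    by (simp add: R_def)
qed

definition nc_shuffle :: "'a ncps \<Rightarrow> 'a list \<Rightarrow> 'a list \<Rightarrow> complex" where
  "nc_shuffle f u v = (\<Sum>w\<in>#mshuffles u v. nc_coeff f w)"

text \<open>The coefficient functional is multiplicative on the shuffle algebra. With constant term
  1 this is group-likeness for the dual coproduct; \<open>nc_lie\<close> is primitivity, which is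
  Ree's criterion for Lie series.\<close>

definition grouplike :: "'a ncps \<Rightarrow> bool" where
  "grouplike f \<longleftrightarrow> (\<forall>u v. nc_coeff f u * nc_coeff f v = nc_shuffle f u v)"

definition nc_lie :: "'a ncps \<Rightarrow> bool" where
  "nc_lie f \<longleftrightarrow> nc_coeff f [] = 0 \<and> (\<forall>u v. u \<noteq> [] \<longrightarrow> v \<noteq> [] \<longrightarrow> nc_shuffle f u v = 0)"

lemma nc_shuffle_Nil [simp]: "nc_shuffle f u [] = nc_coeff f u" "nc_shuffle f [] u = nc_coeff f u"
  by (simp_all add: nc_shuffle_def)

text \<open>The deconcatenation identity for \<open>\<phi> a b\<close> equal to the product of the
  coefficient of \<open>f\<close> at \<open>a\<close> and that of \<open>g\<close> at
  \<open>b\<close>; dually, the coproduct is an algebra homomorphism.\<close>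

lemma nc_shuffle_mult:
  "nc_shuffle (f * g) u v = (\<Sum>i\<le>length u. \<Sum>j\<le>length v.
     nc_shuffle f (take i u) (take j v) * nc_shuffle g (drop i u) (drop j v))"
  unfolding nc_shuffle_def nc_coeff_mult sum_mshuffles_deconcat [of "\<lambda>a b. nc_coeff f a * nc_coeff g b"]
  by (simp only: sum_mset_distrib_right) (simp only: sum_mset_distrib_left)

lemma length_in_mshuffles: "w \<in># mshuffles u v \<Longrightarrow> length w = length u + length v"
  by (induction u v arbitrary: w rule: mshuffles.induct) auto

lemma nc_shuffle_one: "nc_shuffle 1 u v = nc_coeff 1 u * nc_coeff 1 v"
proof (cases "u = [] \<or> v = []")
  case True
  then show ?thesis by (auto simp: nc_coeff_one)
next
  case False
  then have "nc_coeff 1 w = 0" if "w \<in># mshuffles u v" for w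
    using length_in_mshuffles [OF that] by (auto simp: nc_coeff_one)
  then have "nc_shuffle 1 u v = (\<Sum>w\<in>#mshuffles u v. 0)"
    unfolding nc_shuffle_def by (intro arg_cong [where f = sum_mset] image_mset_cong) auto
  then show ?thesis
    using False by (simp add: nc_coeff_one)
qed

lemma grouplike_mult:
  assumes "grouplike f" "grouplike g"
  shows "grouplike (f * g)"
  unfolding grouplike_def
proof (intro allI)
  fix u v
  have "nc_shuffle (f * g) u v = (\<Sum>i\<le>length u. \<Sum>j\<le>length v.
     (nc_coeff f (take i u) * nc_coeff f (take j v)) * (nc_coeff g (drop i u) * nc_coeff g (drop j v)))"
    using assms by (simp add: nc_shuffle_mult grouplike_def)
  also have "\<dots> = nc_coeff (f * g) u * nc_coeff (f * g) v"
    by (simp add: nc_coeff_mult sum_product mult_ac)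
  finally show "nc_coeff (f * g) u * nc_coeff (f * g) v = nc_shuffle (f * g) u v" ..
qed

text \<open>Induction on the total length of \<open>u\<close> and \<open>v\<close>. Expanding the
  shuffle relation of \<open>f * g = 1\<close>, every term except the one with both prefixes empty
  contains the defect of \<open>g\<close> at a shorter pair and vanishes; the remaining term is the
  defect at \<open>u\<close> and \<open>v\<close>.\<close>

lemma grouplike_inverse:
  assumes "grouplike f" "nc_coeff f [] = 1"
  shows "grouplike (nc_inverse f)"
proof -
  define g where "g = nc_inverse f"
  have fg: "f * g = 1"
    by (simp add: g_def nc_right_inverse assms)
  have sf: "nc_shuffle f u v = nc_coeff f u * nc_coeff f v" for u v
    using assms(1) by (simp add: grouplike_def)
  have "nc_shuffle g u v = nc_coeff g u * nc_coeff g v" for u v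
  proof (induction "length u + length v" arbitrary: u v rule: less_induct)
    case less
    define d where "d i j = nc_coeff f (take i u) * nc_coeff f (take j v) *
        (nc_shuffle g (drop i u) (drop j v) - nc_coeff g (drop i u) * nc_coeff g (drop j v))" for i j
    have d0: "d i j = 0" if "i \<le> length u" "j \<le> length v" "(i, j) \<noteq> (0, 0)" for i j
    proof -
      have "length (drop i u) + length (drop j v) < length u + length v"
        using that by auto
      then show ?thesis
        using less by (simp add: d_def)
    qed
    have "(\<Sum>p\<in>{..length u} \<times> {..length v}. d (fst p) (snd p)) = (\<Sum>p\<in>{(0,0)}. d (fst p) (snd p))"
      by (rule sum.mono_neutral_right) (auto intro!: d0)
    then have "(\<Sum>i\<le>length u. \<Sum>j\<le>length v. d i j) = d 0 0"
      by (simp add: sum.cartesian_product case_prod_unfold)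
    moreover have "(\<Sum>i\<le>length u. \<Sum>j\<le>length v. d i j) =
        nc_shuffle (f * g) u v - nc_coeff (f * g) u * nc_coeff (f * g) v"
      by (simp add: d_def nc_shuffle_mult sf nc_coeff_mult sum_product right_diff_distrib
            sum_subtractf mult_ac)
    moreover have "\<dots> = 0"
      by (simp add: fg nc_shuffle_one)
    ultimately show ?case
      by (simp add: d_def assms)
  qed
  then show ?thesis
    by (simp add: grouplike_def g_def)
qed

section \<open>Exponentials of linear combinations of letters\<close>

lemma nc_coeff_power_letters:
  assumes "\<And>w. length w \<noteq> 1 \<Longrightarrow> nc_coeff f w = 0"
  shows "nc_coeff (f ^ n) w = (if length w = n then (\<Prod>x\<leftarrow>w. nc_coeff f [x]) else 0)"
proof (induction n arbitrary: w)
  case 0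
  then show ?case by (simp add: nc_coeff_one)
next
  case (Suc n)
  show ?case
  proof (cases w)
    case Nil
    then show ?thesis using assms [of "[]"] by simp
  next
    case (Cons x xs)
    have "nc_coeff (f * f ^ n) w = (\<Sum>k\<in>{1}. nc_coeff f (take k w) * nc_coeff (f ^ n) (drop k w))"
      unfolding nc_coeff_mult
      by (rule sum.mono_neutral_right) (auto simp: Cons assms min_def)
    then show ?thesis
      by (simp add: Cons Suc.IH)
  qed
qed

lemma nc_coeff_exp_letters:
  assumes "\<And>w. length w \<noteq> 1 \<Longrightarrow> nc_coeff f w = 0"
  shows "nc_coeff (nc_exp f) w = (\<Prod>x\<leftarrow>w. nc_coeff f [x]) / fact (length w)"
proof -
  have "(\<Sum>n. nc_coeff (f ^ n) w / fact n) = (\<Sum>n\<in>{length w}. nc_coeff (f ^ n) w / fact n)"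
    by (rule suminf_finite) (auto simp: nc_coeff_power_letters [OF assms])
  then show ?thesis
    by (simp add: nc_exp_def nc_coeff_power_letters [OF assms])
qed

text \<open>The one-parameter group generated by the sum of \<open>c x\<close> times
  \<open>x\<close> over all letters \<open>x\<close>. Both the factor \<open>E\<close> and the
  integrals of a constant form supported on letters are of this shape.\<close>

definition letter_exp :: "('a \<Rightarrow> complex) \<Rightarrow> complex \<Rightarrow> 'a ncps" where
  "letter_exp c z = nc_exp (NC (\<lambda>w. if length w = 1 then z * c (hd w) else 0))"

lemma nc_coeff_letter_exp:
  "nc_coeff (letter_exp c z) w = z ^ length w * (\<Prod>x\<leftarrow>w. c x) / fact (length w)"
proof -
  have "(\<Prod>x\<leftarrow>w. z * c x) = z ^ length w * (\<Prod>x\<leftarrow>w. c x)"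
    by (induction w) auto
  then show ?thesis
    unfolding letter_exp_def by (subst nc_coeff_exp_letters) auto
qed

lemma letter_exp_0: "letter_exp c 0 = 1"
  by (rule ncps_eqI) (simp add: nc_coeff_letter_exp nc_coeff_one)

text \<open>Multiples of one series commute. In coefficients this is the binomial theorem, because
  the product of \<open>c\<close> over a word is multiplicative under cutting.\<close>

lemma letter_exp_add: "letter_exp c (y + z) = letter_exp c y * letter_exp c z"
proof (rule ncps_eqI)
  fix w :: "'a list"
  have "nc_coeff (letter_exp c y * letter_exp c z) w =
      (\<Sum>k\<le>length w. (y ^ k * z ^ (length w - k) / (fact k * fact (length w - k))) * (\<Prod>x\<leftarrow>w. c x))"
    unfolding nc_coeff_mult
  proof (rule sum.cong)
    fix k assume "k \<in> {..length w}"
    moreover have "(\<Prod>x\<leftarrow>w. c x) = (\<Prod>x\<leftarrow>take k w. c x) * (\<Prod>x\<leftarrow>drop k w. c x)"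
      by (metis append_take_drop_id map_append prod_list.append)
    ultimately show "nc_coeff (letter_exp c y) (take k w) * nc_coeff (letter_exp c z) (drop k w) =
        (y ^ k * z ^ (length w - k) / (fact k * fact (length w - k))) * (\<Prod>x\<leftarrow>w. c x)"
      by (simp add: nc_coeff_letter_exp)
  qed simp
  also have "\<dots> = (y + z) ^ length w / fact (length w) * (\<Prod>x\<leftarrow>w. c x)"
    unfolding binomial_ring sum_divide_distrib sum_distrib_right
    by (rule sum.cong) (auto simp: binomial_fact)
  finally show "nc_coeff (letter_exp c (y + z)) w = nc_coeff (letter_exp c y * letter_exp c z) w"
    by (simp add: nc_coeff_letter_exp)
qed

lemma size_mshuffles: "size (mshuffles u v) = (length u + length v) choose length u"
  by (induction u v rule: mshuffles.induct) (auto simp: algebra_simps)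

lemma prod_list_mshuffles:
  fixes c :: "'a \<Rightarrow> complex"
  shows "w \<in># mshuffles u v \<Longrightarrow> (\<Prod>x\<leftarrow>w. c x) = (\<Prod>x\<leftarrow>u. c x) * (\<Prod>x\<leftarrow>v. c x)"
  by (induction u v arbitrary: w rule: mshuffles.induct) auto

text \<open>The coefficient is constant on the shuffles of \<open>u\<close> and \<open>v\<close>,
  and their number, a binomial coefficient, turns the factorial of the total length into the two
  separate factorials.\<close>

lemma grouplike_letter_exp:
  fixes c :: "'a \<Rightarrow> complex"
  shows "grouplike (letter_exp c z)"
  unfolding grouplike_def
proof (intro allI)
  fix u v :: "'a list"
  let ?c = "\<lambda>w. \<Prod>x\<leftarrow>w. c x" and ?n = "length u + length v"
  have "nc_shuffle (letter_exp c z) u v = (\<Sum>w\<in>#mshuffles u v. z ^ ?n * (?c u * ?c v) / fact ?n)"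
    unfolding nc_shuffle_def
    by (intro arg_cong [where f = sum_mset] image_mset_cong)
       (auto simp: nc_coeff_letter_exp length_in_mshuffles prod_list_mshuffles)
  also have "\<dots> = of_nat (?n choose length u) * (z ^ ?n * (?c u * ?c v) / fact ?n)"
    by (simp add: size_mshuffles)
  also have "\<dots> = nc_coeff (letter_exp c z) u * nc_coeff (letter_exp c z) v"
    by (simp add: nc_coeff_letter_exp binomial_fact power_add)
  finally show "nc_coeff (letter_exp c z) u * nc_coeff (letter_exp c z) v =
      nc_shuffle (letter_exp c z) u v" ..
qed

section \<open>Iterated integrals as solutions of a differential equation\<close>

definition has_nc_derivative :: "(complex \<Rightarrow> 'a ncps) \<Rightarrow> 'a ncps \<Rightarrow> complex \<Rightarrow> bool" where
  "has_nc_derivative F F' z \<longleftrightarrow>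
     (\<forall>w. ((\<lambda>t. nc_coeff (F t) w) has_field_derivative nc_coeff F' w) (at z))"

lemma has_nc_derivative_mult:
  assumes "has_nc_derivative F F' z" "has_nc_derivative G G' z"
  shows "has_nc_derivative (\<lambda>t. F t * G t) (F' * G z + F z * G') z"
  unfolding has_nc_derivative_def
proof
  fix w :: "'a list"
  have "((\<lambda>t. \<Sum>k\<le>length w. nc_coeff (F t) (take k w) * nc_coeff (G t) (drop k w))
     has_field_derivative (\<Sum>k\<le>length w. nc_coeff F' (take k w) * nc_coeff (G z) (drop k w) +
        nc_coeff G' (drop k w) * nc_coeff (F z) (take k w))) (at z)"
    using assms unfolding has_nc_derivative_def by (intro DERIV_sum DERIV_mult) auto
  then show "((\<lambda>t. nc_coeff (F t * G t) w) has_field_derivative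
      nc_coeff (F' * G z + F z * G') w) (at z)"
    by (simp add: nc_coeff_mult sum.distrib mult.commute)
qed

lemma has_nc_derivative_const: "has_nc_derivative (\<lambda>_. c) 0 z"
  by (simp add: has_nc_derivative_def)

lemma has_nc_derivative_mult_const:
  assumes "has_nc_derivative F F' z"
  shows "has_nc_derivative (\<lambda>t. F t * c) (F' * c) z"
  using has_nc_derivative_mult [OF assms has_nc_derivative_const] by simp

lemma has_nc_derivative_unique:
  assumes "has_nc_derivative F F' z" "has_nc_derivative F F'' z"
  shows "F' = F''"
  using assms unfolding has_nc_derivative_def by (intro ncps_eqI) (blast intro: DERIV_unique)

lemma has_nc_derivative_transform:
  assumes "has_nc_derivative F F' z" "open S" "z \<in> S" "\<And>t. t \<in> S \<Longrightarrow> F t = G t"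
  shows "has_nc_derivative G F' z"
  unfolding has_nc_derivative_def
proof
  fix w
  show "((\<lambda>t. nc_coeff (G t) w) has_field_derivative nc_coeff F' w) (at z)"
    using assms(1) unfolding has_nc_derivative_def
    by (rule has_field_derivative_transform_within_open [where S = S, OF spec [where x = w]])
       (use assms in auto)
qed

lemma nc_constant_on_convex:
  assumes "convex S" "\<And>z. z \<in> S \<Longrightarrow> (f has_field_derivative 0) (at z)" "a \<in> S" "z \<in> S"
  shows "(f :: complex \<Rightarrow> complex) z = f a"
proof -
  have "(f has_field_derivative 0) (at z within S)" if "z \<in> S" for z
    using assms(2) [OF that] has_field_derivative_at_within by blast
  then obtain c where "\<And>z. z \<in> S \<Longrightarrow> f z = c"
    using has_field_derivative_zero_constant [OF assms(1)] by metis
  then show ?thesis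
    using assms by simp
qed

text \<open>Induction on the word length: since \<open>\<Omega>\<close> has no constant term, the
  derivative at \<open>w\<close> involves \<open>F\<close> and \<open>G\<close> only at proper
  suffixes, where they agree. The difference at \<open>w\<close> is therefore constant, and it
  vanishes at \<open>a\<close>.\<close>

lemma nc_ode_unique:
  assumes S: "convex S" "a \<in> S" "z \<in> S"
    and F: "\<And>t. t \<in> S \<Longrightarrow> has_nc_derivative F (- (\<Omega> t * F t)) t"
    and G: "\<And>t. t \<in> S \<Longrightarrow> has_nc_derivative G (- (\<Omega> t * G t)) t"
    and \<Omega>: "\<And>t. t \<in> S \<Longrightarrow> nc_coeff (\<Omega> t) [] = 0"
    and eq: "F a = G a"
  shows "F z = G z"
proof -
  define e where "e t w = nc_coeff (F t) w - nc_coeff (G t) w" for t w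
  have "\<forall>t\<in>S. e t w = 0" for w
  proof (induction "length w" arbitrary: w rule: less_induct)
    case less
    have "((\<lambda>t. e t w) has_field_derivative 0) (at t)" if "t \<in> S" for t
    proof -
      have "((\<lambda>t. e t w) has_field_derivative
          nc_coeff (- (\<Omega> t * F t)) w - nc_coeff (- (\<Omega> t * G t)) w) (at t)"
        using F [OF that] G [OF that] unfolding has_nc_derivative_def e_def by (intro DERIV_diff) auto
      moreover have "nc_coeff (F t) (drop k w) = nc_coeff (G t) (drop k w)" if "k \<in> {1..length w}" for k
      proof -
        have "length (drop k w) < length w"
          using that by auto
        then show ?thesis
          using less \<open>t \<in> S\<close> by (simp add: e_def)
      qed
      then have "nc_coeff (\<Omega> t * F t) w = nc_coeff (\<Omega> t * G t) w"
        using \<Omega> [OF that] by (simp add: nc_coeff_mult_split_left)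
      ultimately show ?thesis by simp
    qed
    then have "e t w = e a w" if "t \<in> S" for t
      using nc_constant_on_convex [of S "\<lambda>t. e t w" a t] S that by blast
    then show ?case
      using eq by (simp add: e_def)
  qed
  then show ?thesis
    using S by (intro ncps_eqI) (simp add: e_def)
qed

lemma has_field_derivative_sum_mset:
  assumes "\<And>w. w \<in># M \<Longrightarrow> ((\<lambda>t. f t w) has_field_derivative f' w) (at z)"
  shows "((\<lambda>t. \<Sum>w\<in>#M. f t w) has_field_derivative (\<Sum>w\<in>#M. f' w)) (at z)"
  using assms by (induction M) (auto intro!: DERIV_add)

lemma nc_shuffle_uminus: "nc_shuffle (- f) u v = - nc_shuffle f u v"
proof -
  have "(\<Sum>w\<in>#M. - nc_coeff f w) = - (\<Sum>w\<in>#M. nc_coeff f w)" for M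
    by (induction M) auto
  then show ?thesis
    by (simp add: nc_shuffle_def)
qed

lemma has_nc_derivative_shuffle:
  assumes "has_nc_derivative F F' z"
  shows "((\<lambda>t. nc_shuffle (F t) u v) has_field_derivative nc_shuffle F' u v) (at z)"
  using assms unfolding has_nc_derivative_def nc_shuffle_def
  by (intro has_field_derivative_sum_mset) auto

section \<open>Iterated integrals of a holomorphic form on a convex domain\<close>

locale nc_form =
  fixes S :: "complex set" and \<Omega> :: "complex \<Rightarrow> 'a ncps"
  assumes open_S: "open S" and convex_S: "convex S"
    and holomorphic_form: "\<And>w. (\<lambda>t. nc_coeff (\<Omega> t) w) holomorphic_on S"
    and form_Nil: "\<And>t. nc_coeff (\<Omega> t) [] = 0"
begin

text \<open>On a convex domain the integrand has a primitive \<open>g\<close>, and the integral from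
  \<open>t\<close> to \<open>b\<close> is \<open>g b - g t\<close>, whence the minus sign.
  Holomorphy at level \<open>n\<close> is a hypothesis so that the lemma can serve as the induction
  step of \<open>holomorphic_iter_int_n\<close>.\<close>

lemma has_nc_derivative_iter_int_n_aux:
  assumes "b \<in> S" "\<And>w. (\<lambda>t. nc_coeff (iter_int_n \<Omega> n t b) w) holomorphic_on S" "z \<in> S"
  shows "has_nc_derivative (\<lambda>t. iter_int_n \<Omega> (Suc n) t b) (- (\<Omega> z * iter_int_n \<Omega> n z b)) z"
  unfolding has_nc_derivative_def
proof
  fix w
  let ?f = "\<lambda>t. nc_coeff (\<Omega> t * iter_int_n \<Omega> n t b) w"
  have "?f holomorphic_on S"
    unfolding nc_coeff_mult by (intro holomorphic_intros holomorphic_form assms)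
  then obtain g where g: "\<And>x. x \<in> S \<Longrightarrow> (g has_field_derivative ?f x) (at x within S)"
    using holomorphic_convex_primitive' [OF convex_S open_S] by blast
  have eq: "contour_integral (linepath t b) ?f = g b - g t" if "t \<in> S" for t
  proof -
    have "(?f has_contour_integral (g (pathfinish (linepath t b)) - g (pathstart (linepath t b)))) (linepath t b)"
      using that assms convex_S
      by (intro contour_integral_primitive [OF g]) (auto simp: closed_segment_subset)
    from contour_integral_unique [OF this] show ?thesis
      by simp
  qed
  have "(g has_field_derivative ?f z) (at z)"
    using g [OF assms(3)] unfolding at_within_open [OF assms(3) open_S] .
  from DERIV_diff [OF DERIV_const this]
  have "((\<lambda>t. g b - g t) has_field_derivative - ?f z) (at z)"
    by simp
  then show "((\<lambda>t. nc_coeff (iter_int_n \<Omega> (Suc n) t b) w) has_field_derivative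
      nc_coeff (- (\<Omega> z * iter_int_n \<Omega> n z b)) w) (at z)"
    unfolding nc_coeff_uminus
    by (rule has_field_derivative_transform_within_open [where S = S])
       (simp_all add: assms open_S eq)
qed

lemma holomorphic_iter_int_n:
  assumes "b \<in> S"
  shows "(\<lambda>t. nc_coeff (iter_int_n \<Omega> n t b) w) holomorphic_on S"
proof (induction n arbitrary: w)
  case 0
  then show ?case by simp
next
  case (Suc n)
  show ?case
    using has_nc_derivative_iter_int_n_aux [OF assms Suc] open_S
    unfolding has_nc_derivative_def by (auto simp: holomorphic_on_open)
qed

lemmas has_nc_derivative_iter_int_n =
  has_nc_derivative_iter_int_n_aux [OF _ holomorphic_iter_int_n]

text \<open>Each factor \<open>\<Omega>\<close> consumes at least one letter. Hence the series
  \<open>iter_int\<close> is a finite sum at every word.\<close>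

lemma iter_int_n_eq_0: "length w < n \<Longrightarrow> nc_coeff (iter_int_n \<Omega> n z b) w = 0"
proof (induction n arbitrary: w z)
  case 0
  then show ?case by simp
next
  case (Suc n)
  have "nc_coeff (\<Omega> t * iter_int_n \<Omega> n t b) w = 0" for t
    unfolding nc_coeff_mult_split_left form_Nil using Suc by (auto intro!: sum.neutral)
  then show ?case by simp
qed

text \<open>The free bound \<open>N\<close> allows a word and all its suffixes to be expanded over
  one common range.\<close>

lemma nc_coeff_iter_int:
  assumes "length w \<le> N"
  shows "nc_coeff (iter_int \<Omega> z b) w = (\<Sum>n\<le>N. nc_coeff (iter_int_n \<Omega> n z b) w)"
  unfolding iter_int_def nc_coeff_NC
  by (rule suminf_finite) (use assms iter_int_n_eq_0 in auto)

lemma iter_int_Nil: "nc_coeff (iter_int \<Omega> z b) [] = 1"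
  by (simp add: nc_coeff_iter_int [where N = 0] nc_coeff_one)

lemma iter_int_refl: "iter_int \<Omega> b b = 1"
proof (rule ncps_eqI)
  fix w
  have "nc_coeff (iter_int_n \<Omega> n b b) w = 0" if "n > 0" for n
    using that by (cases n) auto
  then have "(\<Sum>n\<le>length w. nc_coeff (iter_int_n \<Omega> n b b) w) =
      (\<Sum>n\<in>{0}. nc_coeff (iter_int_n \<Omega> n b b) w)"
    by (intro sum.mono_neutral_right) auto
  then show "nc_coeff (iter_int \<Omega> b b) w = nc_coeff 1 w"
    by (simp add: nc_coeff_iter_int [OF order_refl])
qed

lemma has_nc_derivative_iter_int:
  assumes "b \<in> S" "z \<in> S"
  shows "has_nc_derivative (\<lambda>t. iter_int \<Omega> t b) (- (\<Omega> z * iter_int \<Omega> z b)) z"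
  unfolding has_nc_derivative_def
proof
  fix w :: "'a list"
  let ?N = "length w"
  have drop: "nc_coeff (iter_int \<Omega> z b) (drop k w) = (\<Sum>n\<le>?N. nc_coeff (iter_int_n \<Omega> n z b) (drop k w))" for k
    by (rule nc_coeff_iter_int) auto
  \<comment> \<open>Differentiation lowers the level by one, so the sum runs to
    \<open>Suc ?N\<close> in order that the derivatives fill the range \<open>n \<le> ?N\<close>
    used for the suffixes; the 0 comes from the constant level 0.\<close>
  have "((\<lambda>t. \<Sum>n\<le>Suc ?N. nc_coeff (iter_int_n \<Omega> n t b) w) has_field_derivative
      0 + (\<Sum>n\<le>?N. nc_coeff (- (\<Omega> z * iter_int_n \<Omega> n z b)) w)) (at z)"
    unfolding sum.atMost_Suc_shift
    using has_nc_derivative_iter_int_n [OF assms(1) assms] unfolding has_nc_derivative_def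
    by (intro DERIV_add DERIV_sum) auto
  also have "(\<lambda>t. \<Sum>n\<le>Suc ?N. nc_coeff (iter_int_n \<Omega> n t b) w) = (\<lambda>t. nc_coeff (iter_int \<Omega> t b) w)"
    by (intro ext nc_coeff_iter_int [symmetric]) auto
  also have "0 + (\<Sum>n\<le>?N. nc_coeff (- (\<Omega> z * iter_int_n \<Omega> n z b)) w) =
      nc_coeff (- (\<Omega> z * iter_int \<Omega> z b)) w"
    unfolding nc_coeff_uminus nc_coeff_mult drop sum_distrib_left
    by (subst sum.swap) (simp add: sum_negf)
  finally show "((\<lambda>t. nc_coeff (iter_int \<Omega> t b) w) has_field_derivative
      nc_coeff (- (\<Omega> z * iter_int \<Omega> z b)) w) (at z)" .
qed

text \<open>As functions of the left endpoint both sides solve the same equation, and they agree at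
  \<open>b\<close>.\<close>

lemma iter_int_trans:
  assumes "a \<in> S" "b \<in> S" "c \<in> S"
  shows "iter_int \<Omega> a b * iter_int \<Omega> b c = iter_int \<Omega> a c"
proof (rule nc_ode_unique [where \<Omega> = \<Omega> and F = "\<lambda>t. iter_int \<Omega> t b * iter_int \<Omega> b c" and G = "\<lambda>t. iter_int \<Omega> t c" and a = b and S = S])
  fix t assume "t \<in> S"
  show "has_nc_derivative (\<lambda>t. iter_int \<Omega> t b * iter_int \<Omega> b c)
      (- (\<Omega> t * (iter_int \<Omega> t b * iter_int \<Omega> b c))) t"
    using has_nc_derivative_mult_const [OF has_nc_derivative_iter_int [OF assms(2) \<open>t \<in> S\<close>]]
    by (simp add: mult.assoc)
qed (use assms in \<open>auto simp: iter_int_refl form_Nil convex_S intro: has_nc_derivative_iter_int\<close>)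

lemma iter_int_inverse:
  assumes "a \<in> S" "b \<in> S"
  shows "iter_int \<Omega> a b * iter_int \<Omega> b a = 1"
  using iter_int_trans [OF assms assms(1)] by (simp add: iter_int_refl)

text \<open>The relation \<open>iter_int \<Omega> t a * iter_int \<Omega> a t = 1\<close> expresses
  each coefficient through shorter words and through the left endpoint, where holomorphy is
  known.\<close>

lemma holomorphic_iter_int_right:
  assumes "a \<in> S"
  shows "(\<lambda>t. nc_coeff (iter_int \<Omega> a t) w) holomorphic_on S"
proof (induction "length w" arbitrary: w rule: less_induct)
  case less
  show ?case
  proof (cases "w = []")
    case True
    then show ?thesis by (simp add: iter_int_Nil)
  next
    case False
    have "(\<lambda>t. nc_coeff (iter_int \<Omega> t a) v) holomorphic_on S" for v
      using has_nc_derivative_iter_int [OF assms] open_S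
      unfolding has_nc_derivative_def by (auto simp: holomorphic_on_open)
    then have "(\<lambda>t. - (\<Sum>k\<in>{1..length w}. nc_coeff (iter_int \<Omega> t a) (take k w) *
        nc_coeff (iter_int \<Omega> a t) (drop k w))) holomorphic_on S"
      by (intro holomorphic_intros less) auto
    then show ?thesis
    proof (rule holomorphic_transform)
      fix t assume "t \<in> S"
      then have "nc_coeff (iter_int \<Omega> t a * iter_int \<Omega> a t) w = 0"
        using assms False by (simp add: iter_int_inverse nc_coeff_one)
      then show "- (\<Sum>k\<in>{1..length w}. nc_coeff (iter_int \<Omega> t a) (take k w) *
          nc_coeff (iter_int \<Omega> a t) (drop k w)) = nc_coeff (iter_int \<Omega> a t) w"
        by (simp add: nc_coeff_mult_split_left iter_int_Nil add_eq_0_iff)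
    qed
  qed
qed

text \<open>Differentiate \<open>iter_int \<Omega> z a * iter_int \<Omega> a z = 1\<close> and solve
  for the derivative of the second factor.\<close>

lemma has_nc_derivative_iter_int_right:
  assumes "a \<in> S" "z \<in> S"
  shows "has_nc_derivative (\<lambda>t. iter_int \<Omega> a t) (iter_int \<Omega> a z * \<Omega> z) z"
proof -
  define D where "D = NC (\<lambda>w. deriv (\<lambda>t. nc_coeff (iter_int \<Omega> a t) w) z)"
  have D: "has_nc_derivative (\<lambda>t. iter_int \<Omega> a t) D z"
    unfolding has_nc_derivative_def D_def nc_coeff_NC
    using holomorphic_iter_int_right [OF assms(1)] open_S assms(2)
    by (blast intro: holomorphic_derivI)
  have "has_nc_derivative (\<lambda>_. 1) (- (\<Omega> z * iter_int \<Omega> z a) * iter_int \<Omega> a z + iter_int \<Omega> z a * D) z"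
    by (rule has_nc_derivative_transform
          [OF has_nc_derivative_mult [OF has_nc_derivative_iter_int D] open_S])
       (use assms in \<open>auto simp: iter_int_inverse\<close>)
  then have "iter_int \<Omega> z a * D = \<Omega> z * iter_int \<Omega> z a * iter_int \<Omega> a z"
    using has_nc_derivative_unique [OF _ has_nc_derivative_const]
    by (metis add_eq_0_iff minus_mult_left minus_minus)
  then have "iter_int \<Omega> z a * D = \<Omega> z"
    using assms by (simp add: mult.assoc iter_int_inverse)
  then have "iter_int \<Omega> a z * \<Omega> z = iter_int \<Omega> a z * iter_int \<Omega> z a * D"
    by (simp add: mult.assoc)
  then show ?thesis
    using D assms by (simp add: iter_int_inverse)
qed

text \<open>By the chain rule the left side, as a function of \<open>a\<close>, solves the equation
  belonging to \<open>\<Omega>\<close>, and it equals 1 at \<open>b\<close>.\<close>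

lemma iter_int_pullback:
  fixes \<phi> \<phi>' :: "complex \<Rightarrow> complex"
  assumes T: "nc_form T \<Omega>'" and ab: "a \<in> S" "b \<in> S"
    and \<phi>: "\<And>t. t \<in> S \<Longrightarrow> (\<phi> has_field_derivative \<phi>' t) (at t)" "\<And>t. t \<in> S \<Longrightarrow> \<phi> t \<in> T"
    and eq: "\<And>t w. t \<in> S \<Longrightarrow> nc_coeff (\<Omega>' (\<phi> t)) w * \<phi>' t = nc_coeff (\<Omega> t) w"
  shows "iter_int \<Omega>' (\<phi> a) (\<phi> b) = iter_int \<Omega> a b"
proof (rule nc_ode_unique [where \<Omega> = \<Omega> and F = "\<lambda>t. iter_int \<Omega>' (\<phi> t) (\<phi> b)" and G = "\<lambda>t. iter_int \<Omega> t b" and a = b and S = S])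
  interpret T: nc_form T \<Omega>' by fact
  show "iter_int \<Omega>' (\<phi> b) (\<phi> b) = iter_int \<Omega> b b"
    by (simp add: T.iter_int_refl iter_int_refl)
  fix t assume t: "t \<in> S"
  show "has_nc_derivative (\<lambda>t. iter_int \<Omega>' (\<phi> t) (\<phi> b)) (- (\<Omega> t * iter_int \<Omega>' (\<phi> t) (\<phi> b))) t"
    unfolding has_nc_derivative_def
  proof
    fix w
    have "((\<lambda>x. nc_coeff (iter_int \<Omega>' x (\<phi> b)) w) has_field_derivative
        nc_coeff (- (\<Omega>' (\<phi> t) * iter_int \<Omega>' (\<phi> t) (\<phi> b))) w) (at (\<phi> t))"
      using T.has_nc_derivative_iter_int [OF \<phi>(2) [OF ab(2)] \<phi>(2) [OF t]]
      by (simp add: has_nc_derivative_def)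
    from DERIV_chain2 [OF this \<phi>(1) [OF t]]
    have "((\<lambda>x. nc_coeff (iter_int \<Omega>' (\<phi> x) (\<phi> b)) w) has_field_derivative
        nc_coeff (- (\<Omega>' (\<phi> t) * iter_int \<Omega>' (\<phi> t) (\<phi> b))) w * \<phi>' t) (at t)" .
    also have "nc_coeff (- (\<Omega>' (\<phi> t) * iter_int \<Omega>' (\<phi> t) (\<phi> b))) w * \<phi>' t =
        nc_coeff (- (\<Omega> t * iter_int \<Omega>' (\<phi> t) (\<phi> b))) w"
      by (simp add: nc_coeff_mult sum_distrib_left eq [OF t, symmetric] mult_ac)
    finally show "((\<lambda>x. nc_coeff (iter_int \<Omega>' (\<phi> x) (\<phi> b)) w) has_field_derivative
        nc_coeff (- (\<Omega> t * iter_int \<Omega>' (\<phi> t) (\<phi> b))) w) (at t)" .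
  qed
qed (use assms in \<open>auto simp: form_Nil convex_S intro: has_nc_derivative_iter_int\<close>)

text \<open>The defect \<open>e u v\<close> of the shuffle relation vanishes at \<open>b\<close>. By
  induction on the total length its derivative is 0: as \<open>\<Omega>\<close> is Lie-valued it
  acts on shuffles as a derivation.\<close>

lemma grouplike_iter_int:
  assumes lie: "\<And>t. t \<in> S \<Longrightarrow> nc_lie (\<Omega> t)" and ab: "a \<in> S" "b \<in> S"
  shows "grouplike (iter_int \<Omega> a b)"
proof -
  define I where "I t = iter_int \<Omega> t b" for t
  define e where "e u v = (\<lambda>t. nc_coeff (I t) u * nc_coeff (I t) v - nc_shuffle (I t) u v)" for u v
  have "\<forall>t\<in>S. e u v t = 0" for u v
  proof (induction "length u + length v" arbitrary: u v rule: less_induct)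
    case less
    show ?case
    proof (cases "u = [] \<or> v = []")
      case True
      then show ?thesis by (auto simp: e_def I_def iter_int_Nil)
    next
      case False
      have "(e u v has_field_derivative 0) (at t)" if t: "t \<in> S" for t
      proof -
        let ?D = "- (\<Omega> t * I t)"
        have D: "has_nc_derivative I ?D t"
          unfolding I_def by (rule has_nc_derivative_iter_int) (use ab t in auto)
        have "(e u v has_field_derivative nc_coeff ?D u * nc_coeff (I t) v +
            nc_coeff ?D v * nc_coeff (I t) u - nc_shuffle ?D u v) (at t)"
          unfolding e_def
          by (rule DERIV_diff [OF DERIV_mult has_nc_derivative_shuffle [OF D]])
             (use D in \<open>simp_all add: has_nc_derivative_def\<close>)
        moreover have "nc_shuffle (\<Omega> t * I t) u v =
            nc_coeff (\<Omega> t * I t) u * nc_coeff (I t) v + nc_coeff (\<Omega> t * I t) v * nc_coeff (I t) u"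
        proof -
          \<comment> \<open>The cut \<open>(0, 0)\<close> vanishes because \<open>\<Omega>\<close>
            has no constant term, and cuts with two non-empty prefixes vanish by the Lie condition.
            In the remaining cuts the suffixes form a shorter pair, to which the induction
            hypothesis applies.\<close>
          define \<phi> where "\<phi> i j = nc_shuffle (\<Omega> t) (take i u) (take j v) * nc_shuffle (I t) (drop i u) (drop j v)" for i j
          have sets: "{..length u} = insert 0 {1..length u}" "{..length v} = insert 0 {1..length v}"
            by auto
          have "\<phi> 0 0 = 0"
            by (simp add: \<phi>_def form_Nil)
          moreover have "\<phi> i j = 0" if "i \<in> {1..length u}" "j \<in> {1..length v}" for i j
            using that lie [OF t] False by (simp add: \<phi>_def nc_lie_def)
          ultimately have "nc_shuffle (\<Omega> t * I t) u v =
              (\<Sum>i\<in>{1..length u}. \<phi> i 0) + (\<Sum>j\<in>{1..length v}. \<phi> 0 j)"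
            unfolding nc_shuffle_mult \<phi>_def [symmetric] sets by simp
          moreover have "\<phi> i 0 = nc_coeff (\<Omega> t) (take i u) * nc_coeff (I t) (drop i u) * nc_coeff (I t) v"
            if "i \<in> {1..length u}" for i
          proof -
            have "length (drop i u) + length v < length u + length v"
              using that by auto
            then have "e (drop i u) v t = 0"
              using less t by blast
            then show ?thesis by (simp add: \<phi>_def e_def)
          qed
          moreover have "\<phi> 0 j = nc_coeff (\<Omega> t) (take j v) * nc_coeff (I t) (drop j v) * nc_coeff (I t) u"
            if "j \<in> {1..length v}" for j
          proof -
            have "length u + length (drop j v) < length u + length v"
              using that by auto
            then have "e u (drop j v) t = 0"
              using less t by blast
            then show ?thesis by (simp add: \<phi>_def e_def mult_ac)
          qed
          ultimately show ?thesis
            by (simp add: nc_coeff_mult_split_left form_Nil sum_distrib_right)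
        qed
        moreover have "nc_shuffle ?D u v = - nc_shuffle (\<Omega> t * I t) u v"
          by (rule nc_shuffle_uminus)
        ultimately show ?thesis
          by (simp add: algebra_simps)
      qed
      then have "e u v t = e u v b" if "t \<in> S" for t
        by (rule nc_constant_on_convex [OF convex_S _ ab(2) that])
      moreover have "e u v b = 0"
        by (simp add: e_def I_def iter_int_refl nc_shuffle_one)
      ultimately show ?thesis by simp
    qed
  qed
  then show ?thesis
    using ab by (simp add: grouplike_def e_def I_def)
qed

end

section \<open>Fourier expansions and growth in half-strips\<close>

lemma has_fourier_expansion_powser:
  assumes "has_fourier_expansion f a" "q \<noteq> 0" "norm q < 1"
  shows "(\<lambda>n. a n * q ^ n) sums f (Ln q / (2 * of_real pi * \<i>))"
proof -
  define \<tau> where "\<tau> = Ln q / (2 * of_real pi * \<i>)"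
  have "\<tau> = - \<i> * (Ln q / of_real (2 * pi))"
    by (simp add: \<tau>_def field_simps)
  then have "Im \<tau> = - ln (norm q) / (2 * pi)"
    using assms by (simp add: Re_Ln del: of_real_mult)
  moreover have "ln (norm q) < 0"
    using assms by simp
  ultimately have "\<tau> \<in> uhp"
    by (simp add: uhp_def divide_neg_pos)
  then have "(\<lambda>n. a n * exp (2 * of_real pi * \<i> * of_nat n * \<tau>)) sums f \<tau>"
    using assms(1) by (simp add: has_fourier_expansion_def)
  moreover have "exp (2 * of_real pi * \<i> * of_nat n * \<tau>) = q ^ n" for n
  proof -
    have "2 * of_real pi * \<i> * of_nat n * \<tau> = of_nat n * Ln q"
      by (simp add: \<tau>_def field_simps)
    then show ?thesis
      using exp_Ln [OF assms(2)] by (simp only: exp_of_nat_mult)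
  qed
  ultimately show ?thesis
    by (simp only: \<tau>_def)
qed

text \<open>The difference of the two power series vanishes on the punctured unit disc. Its constant
  term is the limit at 0, and any further non-zero coefficient would contradict the isolation of
  zeros. So the definite description in \<open>fourier_coeff\<close> is meaningful.\<close>

lemma has_fourier_expansion_unique:
  assumes "has_fourier_expansion f a" "has_fourier_expansion f b"
  shows "a = b"
proof
  fix m
  define c where "c n = a n - b n" for n
  have c: "(\<lambda>n. c n * q ^ n) sums 0" if "q \<noteq> 0" "norm q < 1" for q :: complex
    using sums_diff [OF has_fourier_expansion_powser [OF assms(1) that]
        has_fourier_expansion_powser [OF assms(2) that]]
    by (simp add: c_def left_diff_distrib)
  then have "((\<lambda>_ :: complex. 0 :: complex) \<longlongrightarrow> c 0) (at 0)"
    by (intro powser_limit_0_strong [of 1]) auto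
  then have c0: "c 0 = 0"
    using LIM_const_eq by force
  have "c m = 0"
  proof (rule ccontr)
    assume "c m \<noteq> 0"
    moreover from this c0 have "m > 0"
      by (metis gr0I)
    moreover have "(\<lambda>n. c n * (x - 0) ^ n) sums 0" if "norm (x - 0) < 1" for x :: complex
      using c [of x] that c0 powser_sums_zero [of c] by (cases "x = 0") auto
    ultimately obtain s where "0 < s" "\<And>z. z \<in> cball 0 s - {0 :: complex} \<Longrightarrow> (0 :: complex) \<noteq> 0"
      using powser_0_nonzero [of 1 0 c "\<lambda>_. 0" m] by (metis zero_less_one)
    from this(2) [of "of_real s"] this(1) show False
      by simp
  qed
  then show "a m = b m"
    by (simp add: c_def)
qed

lemma fourier_coeff_expansion:
  assumes "modular_form k f"
  shows "has_fourier_expansion f (fourier_coeff f)"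
proof -
  obtain a where a: "has_fourier_expansion f a"
    using assms by (auto simp: modular_form_def)
  then have "fourier_coeff f = a"
    unfolding fourier_coeff_def using has_fourier_expansion_unique by blast
  then show ?thesis
    using a by simp
qed

text \<open>Without its constant term the expansion is divisible by \<open>q\<close>, and the
  quotient is bounded on the disc of radius \<open>r\<close>, which contains all \<open>q\<close>
  with \<open>Im \<tau> \<ge> 1\<close>.\<close>

lemma fourier_expansion_decay:
  assumes "has_fourier_expansion f a"
  shows "\<exists>C. \<forall>\<tau>. Im \<tau> \<ge> 1 \<longrightarrow> norm (f \<tau> - a 0) \<le> C * exp (- (2 * pi * Im \<tau>))"
proof (intro exI allI impI)
  define r where "r = exp (- (2 * pi))"
  have r: "0 < r" "r < 1"
    by (auto simp: r_def)
  \<comment> \<open>Convergence at a point \<open>x\<close> beyond \<open>r\<close> gives absolute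
    convergence at \<open>r\<close>.\<close>
  obtain x where x: "r < x" "x < 1"
    using dense r by blast
  have "summable (\<lambda>n. a n * (of_real x :: complex) ^ n)"
    using has_fourier_expansion_powser [OF assms, of "of_real x"] x r by (auto simp: sums_iff)
  from powser_insidea [OF this, of "of_real r"]
  have "summable (\<lambda>n. norm (a n) * r ^ n)"
    using x r by (simp add: norm_mult norm_power)
  then have "summable (\<lambda>n. norm (a (Suc n)) * r ^ Suc n)"
    by (subst summable_Suc_iff)
  then have sr: "summable (\<lambda>n. norm (a (Suc n)) * r ^ n)"
    using r by (simp add: mult.left_commute)
  fix \<tau> :: complex
  assume \<tau>: "1 \<le> Im \<tau>"
  define q where "q = exp (2 * of_real pi * \<i> * \<tau>)"
  have nq: "norm q = exp (- (2 * pi * Im \<tau>))"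
    by (simp add: q_def)
  also have "\<dots> \<le> r"
    using \<tau> by (simp add: r_def)
  finally have qr: "norm q \<le> r" .
  have "(\<lambda>n. a n * exp (2 * of_real pi * \<i> * of_nat n * \<tau>)) sums f \<tau>"
    using assms \<tau> by (auto simp: has_fourier_expansion_def uhp_def)
  also have "(\<lambda>n. a n * exp (2 * of_real pi * \<i> * of_nat n * \<tau>)) = (\<lambda>n. a n * q ^ n)"
    by (simp add: q_def exp_of_nat_mult [symmetric] mult_ac)
  finally have "(\<lambda>n. a (Suc n) * q ^ Suc n) sums (f \<tau> - a 0)"
    by (subst sums_Suc_iff) simp
  then have eq: "f \<tau> - a 0 = (\<Sum>n. a (Suc n) * q ^ Suc n)"
    by (simp add: sums_iff)
  have le: "norm (a (Suc n) * q ^ Suc n) \<le> norm q * (norm (a (Suc n)) * r ^ n)" for n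
    using power_mono [OF qr, of n]
    by (simp add: norm_mult norm_power mult_left_mono mult.left_commute)
  have "norm (f \<tau> - a 0) \<le> (\<Sum>n. norm q * (norm (a (Suc n)) * r ^ n))"
    unfolding eq by (rule norm_suminf_le [OF le summable_mult [OF sr]])
  also have "\<dots> = (\<Sum>n. norm (a (Suc n)) * r ^ n) * exp (- (2 * pi * Im \<tau>))"
    by (simp add: suminf_mult [OF sr] nq)
  finally show "norm (f \<tau> - a 0) \<le> (\<Sum>n. norm (a (Suc n)) * r ^ n) * exp (- (2 * pi * Im \<tau>))" .
qed

section \<open>Growth and decay in vertical half-strips\<close>

definition exp_growth :: "real \<Rightarrow> (complex \<Rightarrow> complex) \<Rightarrow> bool" where
  "exp_growth c g \<longleftrightarrow>
     (\<forall>N. \<exists>C. \<forall>z. \<bar>Re z\<bar> \<le> N \<longrightarrow> 1 \<le> Im z \<longrightarrow> norm (g z) \<le> C * exp (c * Im z))"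

text \<open>Slower than every growing exponential. Polynomials qualify, and in contrast to a fixed
  positive rate this class is closed under products.\<close>

definition subexp :: "(complex \<Rightarrow> complex) \<Rightarrow> bool" where
  "subexp g \<longleftrightarrow> (\<forall>c>0. exp_growth c g)"

lemma exp_growthE:
  assumes "exp_growth c g"
  obtains C where "C \<ge> 0"
    "\<And>z. \<bar>Re z\<bar> \<le> N \<Longrightarrow> 1 \<le> Im z \<Longrightarrow> norm (g z) \<le> C * exp (c * Im z)"
proof -
  obtain C where C: "\<And>z. \<bar>Re z\<bar> \<le> N \<Longrightarrow> 1 \<le> Im z \<Longrightarrow> norm (g z) \<le> C * exp (c * Im z)"
    using assms unfolding exp_growth_def by blast
  show ?thesis
  proof
    fix z assume "\<bar>Re z\<bar> \<le> N" "1 \<le> Im z"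
    from C [OF this] have "norm (g z) \<le> C * exp (c * Im z)" .
    also have "\<dots> \<le> \<bar>C\<bar> * exp (c * Im z)"
      by (simp add: mult_right_mono)
    finally show "norm (g z) \<le> \<bar>C\<bar> * exp (c * Im z)" .
  qed simp
qed

lemma exp_growth_add:
  assumes "exp_growth c f" "exp_growth c g"
  shows "exp_growth c (\<lambda>z. f z + g z)"
  unfolding exp_growth_def
proof
  fix N
  obtain C where C: "\<And>z. \<bar>Re z\<bar> \<le> N \<Longrightarrow> 1 \<le> Im z \<Longrightarrow> norm (f z) \<le> C * exp (c * Im z)"
    using exp_growthE [OF assms(1)] by metis
  obtain D where D: "\<And>z. \<bar>Re z\<bar> \<le> N \<Longrightarrow> 1 \<le> Im z \<Longrightarrow> norm (g z) \<le> D * exp (c * Im z)"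
    using exp_growthE [OF assms(2)] by metis
  have "norm (f z + g z) \<le> (C + D) * exp (c * Im z)" if "\<bar>Re z\<bar> \<le> N" "1 \<le> Im z" for z
    using norm_triangle_ineq [of "f z" "g z"] C [OF that] D [OF that] by (simp add: distrib_right)
  then show "\<exists>C. \<forall>z. \<bar>Re z\<bar> \<le> N \<longrightarrow> 1 \<le> Im z \<longrightarrow> norm (f z + g z) \<le> C * exp (c * Im z)"
    by blast
qed

lemma exp_growth_mult:
  assumes "exp_growth c f" "exp_growth d g"
  shows "exp_growth (c + d) (\<lambda>z. f z * g z)"
  unfolding exp_growth_def
proof
  fix N
  obtain C where C: "C \<ge> 0" "\<And>z. \<bar>Re z\<bar> \<le> N \<Longrightarrow> 1 \<le> Im z \<Longrightarrow> norm (f z) \<le> C * exp (c * Im z)"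
    using exp_growthE [OF assms(1)] by metis
  obtain D where D: "D \<ge> 0" "\<And>z. \<bar>Re z\<bar> \<le> N \<Longrightarrow> 1 \<le> Im z \<Longrightarrow> norm (g z) \<le> D * exp (d * Im z)"
    using exp_growthE [OF assms(2)] by metis
  have "norm (f z * g z) \<le> (C * D) * exp ((c + d) * Im z)" if "\<bar>Re z\<bar> \<le> N" "1 \<le> Im z" for z
    using mult_mono [OF C(2) [OF that] D(2) [OF that]] C(1)
    by (simp only: norm_mult distrib_right exp_add) (simp add: mult_ac)
  then show "\<exists>C. \<forall>z. \<bar>Re z\<bar> \<le> N \<longrightarrow> 1 \<le> Im z \<longrightarrow> norm (f z * g z) \<le> C * exp ((c + d) * Im z)"
    by blast
qed

lemma exp_growth_mono:
  assumes "exp_growth c f" "c \<le> d"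
  shows "exp_growth d f"
  unfolding exp_growth_def
proof
  fix N
  obtain C where C: "C \<ge> 0" "\<And>z. \<bar>Re z\<bar> \<le> N \<Longrightarrow> 1 \<le> Im z \<Longrightarrow> norm (f z) \<le> C * exp (c * Im z)"
    using exp_growthE [OF assms(1)] by metis
  have "norm (f z) \<le> C * exp (d * Im z)" if "\<bar>Re z\<bar> \<le> N" "1 \<le> Im z" for z
  proof -
    have "C * exp (c * Im z) \<le> C * exp (d * Im z)"
      using C(1) assms(2) that by (intro mult_left_mono) (auto intro: mult_right_mono)
    then show ?thesis
      using C(2) [OF that] by simp
  qed
  then show "\<exists>C. \<forall>z. \<bar>Re z\<bar> \<le> N \<longrightarrow> 1 \<le> Im z \<longrightarrow> norm (f z) \<le> C * exp (d * Im z)"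
    by blast
qed

lemma exp_growth_const:
  assumes "c \<ge> 0"
  shows "exp_growth c (\<lambda>_. a)"
proof (rule exp_growth_mono)
  show "exp_growth 0 (\<lambda>_. a)"
    by (auto simp: exp_growth_def)
qed fact

lemma exp_growth_sum:
  assumes "\<And>i. i \<in> A \<Longrightarrow> exp_growth c (f i)"
  shows "exp_growth c (\<lambda>z. \<Sum>i\<in>A. f i z)"
proof -
  have "exp_growth c (\<lambda>_. 0)"
    by (auto simp: exp_growth_def intro!: exI [of _ 0])
  then show ?thesis
    using assms by (induction A rule: infinite_finite_induct) (auto intro: exp_growth_add)
qed

lemma exp_growth_uminus: "exp_growth c (\<lambda>z. - f z) \<longleftrightarrow> exp_growth c f"
  by (simp add: exp_growth_def)

lemma subexp_const: "subexp (\<lambda>_. a)"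
  by (simp add: subexp_def exp_growth_const)

lemma subexp_add: "subexp f \<Longrightarrow> subexp g \<Longrightarrow> subexp (\<lambda>z. f z + g z)"
  by (simp add: subexp_def exp_growth_add)

lemma subexp_uminus: "subexp f \<Longrightarrow> subexp (\<lambda>z. - f z)"
  by (simp add: subexp_def exp_growth_uminus)

lemma subexp_sum: "(\<And>i. i \<in> A \<Longrightarrow> subexp (f i)) \<Longrightarrow> subexp (\<lambda>z. \<Sum>i\<in>A. f i z)"
  by (simp add: subexp_def exp_growth_sum)

lemma subexp_mult:
  assumes "subexp f" "subexp g"
  shows "subexp (\<lambda>z. f z * g z)"
  unfolding subexp_def
proof (intro allI impI)
  fix c :: real assume "c > 0"
  then have "exp_growth (c / 2 + c / 2) (\<lambda>z. f z * g z)"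
    using assms unfolding subexp_def by (intro exp_growth_mult) auto
  then show "exp_growth c (\<lambda>z. f z * g z)"
    by simp
qed

lemma subexp_power:
  assumes "subexp f"
  shows "subexp (\<lambda>z. f z ^ n)"
  by (induction n) (auto intro: subexp_const subexp_mult assms)

lemma norm_le_exp_growth:
  assumes "0 < c" "\<bar>Re z\<bar> \<le> N" "1 \<le> Im z"
  shows "norm z \<le> (N + 1 / c) * exp (c * Im z)"
proof -
  have "norm z \<le> N + Im z"
    using cmod_le [of z] assms by simp
  moreover have "N \<le> N * exp (c * Im z)"
    using assms by (auto simp: mult_le_cancel_left1)
  moreover have "c * Im z \<le> exp (c * Im z)"
    using exp_ge_add_one_self [of "c * Im z"] by linarith
  then have "Im z \<le> 1 / c * exp (c * Im z)"
    using assms by (simp add: field_simps)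
  ultimately show ?thesis
    by (simp add: distrib_right)
qed

lemma subexp_ident: "subexp (\<lambda>z. z)"
  unfolding subexp_def exp_growth_def using norm_le_exp_growth by blast

text \<open>Mean value estimate on the rectangle containing \<open>\<i>\<close> and
  \<open>z\<close>. Half of the rate \<open>c\<close> bounds the derivative, the other half absorbs
  the distance from \<open>\<i>\<close> to \<open>z\<close>.\<close>

lemma subexp_primitive:
  assumes f: "\<And>z. z \<in> uhp \<Longrightarrow> (f has_field_derivative f' z) (at z)" and f': "subexp f'"
  shows "subexp f"
  unfolding subexp_def exp_growth_def
proof (intro allI impI)
  fix c N :: real
  assume "c > 0"
  then obtain C where C: "C \<ge> 0"
    "\<And>z. \<bar>Re z\<bar> \<le> N \<Longrightarrow> 1 \<le> Im z \<Longrightarrow> norm (f' z) \<le> C * exp (c / 2 * Im z)"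
    using f' exp_growthE unfolding subexp_def by (metis half_gt_zero)
  have "norm (f z) \<le> (norm (f \<i>) + C * (N + 1 / (c / 2) + 1)) * exp (c * Im z)"
    if z: "\<bar>Re z\<bar> \<le> N" "1 \<le> Im z" for z
  proof -
    define S where "S = {x. \<bar>Re x\<bar> \<le> N \<and> 1 \<le> Im x \<and> Im x \<le> Im z}"
    have S: "S = {x. Re x \<le> N} \<inter> {x. Re x \<ge> - N} \<inter> {x. Im x \<ge> 1} \<inter> {x. Im x \<le> Im z}"
      by (auto simp: S_def)
    have "convex S"
      unfolding S by (intro convex_Int convex_halfspace_Re_le convex_halfspace_Re_ge
          convex_halfspace_Im_le convex_halfspace_Im_ge)
    then have "norm (f z - f \<i>) \<le> (C * exp (c / 2 * Im z)) * norm (z - \<i>)"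
    proof (rule field_differentiable_bound [where f' = f'])
      fix x assume x: "x \<in> S"
      then have "x \<in> uhp"
        by (auto simp: S_def uhp_def)
      then show "(f has_field_derivative f' x) (at x within S)"
        using f has_field_derivative_at_within by blast
      have "norm (f' x) \<le> C * exp (c / 2 * Im x)"
        using C(2) [of x] x by (auto simp: S_def)
      also have "\<dots> \<le> C * exp (c / 2 * Im z)"
        using C(1) x \<open>c > 0\<close> by (intro mult_left_mono) (auto simp: S_def)
      finally show "norm (f' x) \<le> C * exp (c / 2 * Im z)" .
    qed (use z in \<open>auto simp: S_def\<close>)
    also have "norm (z - \<i>) \<le> (N + 1 / (c / 2) + 1) * exp (c / 2 * Im z)"
    proof -
      have "norm (z - \<i>) \<le> norm z + 1"
        using norm_triangle_ineq4 [of z \<i>] by simp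
      moreover have "norm z \<le> (N + 1 / (c / 2)) * exp (c / 2 * Im z)"
        using \<open>c > 0\<close> z by (intro norm_le_exp_growth) auto
      moreover have "1 \<le> exp (c / 2 * Im z)"
        using \<open>c > 0\<close> z by simp
      ultimately show ?thesis
        unfolding distrib_right [of _ 1] by linarith
    qed
    finally have "norm (f z - f \<i>) \<le> C * exp (c / 2 * Im z) * ((N + 1 / (c / 2) + 1) * exp (c / 2 * Im z))"
      using C(1) by (simp add: mult_left_mono)
    also have "\<dots> = C * (N + 1 / (c / 2) + 1) * exp (c * Im z)"
      by (simp add: mult_ac exp_add [symmetric])
    finally have "norm (f z - f \<i>) \<le> C * (N + 1 / (c / 2) + 1) * exp (c * Im z)" .
    moreover have "norm (f \<i>) \<le> norm (f \<i>) * exp (c * Im z)"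
      using \<open>c > 0\<close> z by (simp add: mult_le_cancel_left1)
    ultimately show ?thesis
      using norm_triangle_ineq2 [of "f z" "f \<i>"] by (simp add: distrib_right)
  qed
  then show "\<exists>C. \<forall>z. \<bar>Re z\<bar> \<le> N \<longrightarrow> 1 \<le> Im z \<longrightarrow> norm (f z) \<le> C * exp (c * Im z)"
    by blast
qed

text \<open>The bound on \<open>f'\<close> is integrated up the imaginary axis by comparison with
  \<open>- C * exp (- t)\<close>, a primitive of \<open>C * exp (- t)\<close>.\<close>

lemma exp_decay_vertical:
  assumes f: "\<And>z. z \<in> uhp \<Longrightarrow> (f has_field_derivative f' z) (at z)"
    and C: "\<And>y. 1 \<le> y \<Longrightarrow> norm (f' (\<i> * of_real y)) \<le> C * exp (- y)" "C \<ge> 0"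
    and y: "1 \<le> y" "y \<le> y'"
  shows "norm (f (\<i> * of_real y') - f (\<i> * of_real y)) \<le> C * exp (- y)"
proof (cases "y = y'")
  case True
  then show ?thesis using C by simp
next
  case False
  define g where "g = (\<lambda>t::real. f (\<i> * of_real t))"
  have g: "(g has_vector_derivative \<i> * f' (\<i> * of_real t)) (at t)" if "t \<ge> y" for t
  proof -
    have "((\<lambda>x. f (\<i> * x)) has_field_derivative f' (\<i> * of_real t) * \<i>) (at (of_real t))"
      by (rule DERIV_chain2 [where g = "\<lambda>x. \<i> * x", OF f])
         (use that y in \<open>auto simp: uhp_def intro!: derivative_eq_intros\<close>)
    then show ?thesis
      unfolding g_def using has_vector_derivative_real_field by (fastforce simp: mult.commute)
  qed
  have phi: "((\<lambda>t. - C * exp (- t)) has_vector_derivative C * exp (- t)) (at t)" for t :: real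
    unfolding has_real_derivative_iff_has_vector_derivative [symmetric]
    by (auto intro!: derivative_eq_intros)
  have "norm (g y' - g y) \<le> - C * exp (- y') - - C * exp (- y)"
  proof (rule differentiable_bound_general)
    show "y < y'" using y False by simp
    show "continuous_on {y..y'} g"
      using g by (intro continuous_at_imp_continuous_on ballI has_vector_derivative_continuous) auto
    show "continuous_on {y..y'} (\<lambda>t. - C * exp (- t))"
      by (intro continuous_intros)
    fix t assume t: "y < t" "t < y'"
    show "(g has_vector_derivative \<i> * f' (\<i> * of_real t)) (at t)"
      using g t by simp
    show "((\<lambda>t. - C * exp (- t)) has_vector_derivative C * exp (- t)) (at t)"
      by (rule phi)
    show "norm (\<i> * f' (\<i> * of_real t)) \<le> C * exp (- t)"
      using C(1) [of t] t y by (simp add: norm_mult)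
  qed
  moreover have "0 \<le> C * exp (- y')"
    using C(2) by simp
  ultimately show ?thesis
    by (simp add: g_def)
qed

text \<open>The vertical estimate makes the values on the imaginary axis Cauchy, which yields
  \<open>l\<close> and the decay on the axis. Moving horizontally from the axis to \<open>z\<close>,
  a distance of at most \<open>N\<close> at height \<open>Im z\<close>, costs another multiple of
  \<open>exp (- Im z)\<close>.\<close>

lemma exp_decay_primitive:
  assumes f: "\<And>z. z \<in> uhp \<Longrightarrow> (f has_field_derivative f' z) (at z)" and f': "exp_growth (- 1) f'"
  shows "\<exists>l. exp_growth (- 1) (\<lambda>z. f z - l)"
proof -
  obtain C where C: "C \<ge> 0" "\<And>z. \<bar>Re z\<bar> \<le> 0 \<Longrightarrow> 1 \<le> Im z \<Longrightarrow> norm (f' z) \<le> C * exp (- 1 * Im z)"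
    using exp_growthE [OF f'] by metis
  have vert: "norm (f (\<i> * of_real y') - f (\<i> * of_real y)) \<le> C * exp (- y)"
    if "1 \<le> y" "y \<le> y'" for y y'
  proof (rule exp_decay_vertical [OF f _ C(1) that])
    fix t :: real assume "1 \<le> t"
    then show "norm (f' (\<i> * of_real t)) \<le> C * exp (- t)"
      using C(2) [of "\<i> * of_real t"] by simp
  qed
  \<comment> \<open>The index is shifted so that all heights are at least 1, where the bound on
    \<open>f'\<close> holds.\<close>
  define X where "X n = f (\<i> * of_real (real (Suc n)))" for n
  have "(\<lambda>n. C * exp (- real (Suc n))) \<longlonglongrightarrow> 0"
    by real_asymp
  have "Cauchy X"
  proof (rule metric_CauchyI)
    fix e :: real assume "e > 0"
    then have "\<forall>\<^sub>F n in sequentially. C * exp (- real (Suc n)) < e"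
      using \<open>(\<lambda>n. C * exp (- real (Suc n))) \<longlonglongrightarrow> 0\<close> by (intro order_tendstoD)
    then obtain M where M: "\<And>n. n \<ge> M \<Longrightarrow> C * exp (- real (Suc n)) < e"
      by (auto simp: eventually_sequentially)
    have *: "dist (X m) (X n) < e" if "n \<ge> M" "m \<ge> n" for m n
      using vert [of "real (Suc n)" "real (Suc m)"] M [OF that(1)] that
      by (simp add: X_def dist_norm)
    have "dist (X m) (X n) < e" if "n \<ge> M" "m \<ge> M" for m n
      using * [of n m] * [of m n] that by (cases "m \<ge> n") (auto simp: dist_commute)
    then show "\<exists>M. \<forall>m\<ge>M. \<forall>n\<ge>M. dist (X m) (X n) < e"
      by blast
  qed
  then obtain l where l: "X \<longlonglongrightarrow> l"
    using Cauchy_convergent convergentD by blast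
  have axis: "norm (f (\<i> * of_real y) - l) \<le> C * exp (- y)" if "y \<ge> 1" for y
  proof -
    have bound: "norm (X n - f (\<i> * of_real y)) \<le> C * exp (- y)" if "n \<ge> nat \<lceil>y\<rceil>" for n
    proof -
      have "y \<le> real (Suc n)"
        using that by linarith
      then show ?thesis
        using vert [OF \<open>y \<ge> 1\<close>] unfolding X_def by blast
    qed
    have "(\<lambda>n. norm (X n - f (\<i> * of_real y))) \<longlonglongrightarrow> norm (l - f (\<i> * of_real y))"
      by (intro tendsto_intros l)
    then have "norm (l - f (\<i> * of_real y)) \<le> C * exp (- y)"
      by (rule tendsto_upperbound [OF _ eventually_sequentiallyI [OF bound] sequentially_bot])
    then show ?thesis
      by (simp add: norm_minus_commute)
  qed
  have "exp_growth (- 1) (\<lambda>z. f z - l)"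
    unfolding exp_growth_def
  proof
    fix N :: real
    obtain D where D: "D \<ge> 0" "\<And>z. \<bar>Re z\<bar> \<le> N \<Longrightarrow> 1 \<le> Im z \<Longrightarrow> norm (f' z) \<le> D * exp (- 1 * Im z)"
      using exp_growthE [OF f'] by metis
    have "norm (f z - l) \<le> (D * N + C) * exp (- 1 * Im z)" if z: "\<bar>Re z\<bar> \<le> N" "1 \<le> Im z" for z
    proof -
      define S where "S = {x. \<bar>Re x\<bar> \<le> N \<and> Im x = Im z}"
      have S: "S = {x. Re x \<le> N} \<inter> {x. Re x \<ge> - N} \<inter> {x. Im x \<ge> Im z} \<inter> {x. Im x \<le> Im z}"
        by (auto simp: S_def)
      have "convex S"
        unfolding S by (intro convex_Int convex_halfspace_Re_le convex_halfspace_Re_ge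
            convex_halfspace_Im_le convex_halfspace_Im_ge)
      then have "norm (f z - f (\<i> * of_real (Im z))) \<le> (D * exp (- 1 * Im z)) * norm (z - \<i> * of_real (Im z))"
      proof (rule field_differentiable_bound [where f' = f'])
        fix x assume x: "x \<in> S"
        then have "x \<in> uhp"
          using z by (auto simp: S_def uhp_def)
        then show "(f has_field_derivative f' x) (at x within S)"
          using f has_field_derivative_at_within by blast
        show "norm (f' x) \<le> D * exp (- 1 * Im z)"
          using D(2) [of x] x z by (auto simp: S_def)
      qed (use z in \<open>auto simp: S_def\<close>)
      also have "z - \<i> * of_real (Im z) = of_real (Re z)"
        by (simp add: complex_eq_iff)
      also have "D * exp (- 1 * Im z) * norm (of_real (Re z) :: complex) \<le> D * exp (- 1 * Im z) * N"
        using z D(1) by (intro mult_left_mono) auto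
      finally show ?thesis
        using axis [OF z(2)] norm_triangle_ineq [of "f z - f (\<i> * of_real (Im z))" "f (\<i> * of_real (Im z)) - l"]
        by (simp add: algebra_simps)
    qed
    then show "\<exists>C. \<forall>z. \<bar>Re z\<bar> \<le> N \<longrightarrow> 1 \<le> Im z \<longrightarrow> norm (f z - l) \<le> C * exp (- 1 * Im z)"
      by blast
  qed
  then show ?thesis ..
qed

lemma exp_decay_imp_bounded:
  assumes "exp_growth (- 1) (\<lambda>z. f z - l)"
  shows "exp_growth 0 f"
proof -
  have "exp_growth 0 (\<lambda>z. (f z - l) + l)"
    by (intro exp_growth_add exp_growth_const exp_growth_mono [OF assms]) auto
  then show ?thesis by simp
qed

lemma exp_decay_tendsto:
  assumes "exp_growth (- 1) (\<lambda>z. f z - l)"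
  shows "((\<lambda>y. f (of_real x + \<i> * of_real y)) \<longlongrightarrow> l) at_top"
proof -
  obtain C where C: "\<And>z. \<bar>Re z\<bar> \<le> \<bar>x\<bar> \<Longrightarrow> 1 \<le> Im z \<Longrightarrow> norm (f z - l) \<le> C * exp (- 1 * Im z)"
    using exp_growthE [OF assms] by metis
  have "((\<lambda>y. C * exp (- y)) \<longlongrightarrow> 0) at_top"
    by real_asymp
  then have "((\<lambda>y. f (of_real x + \<i> * of_real y) - l) \<longlongrightarrow> 0) at_top"
  proof (rule Lim_null_comparison [rotated])
    show "\<forall>\<^sub>F y in at_top. norm (f (of_real x + \<i> * of_real y) - l) \<le> C * exp (- y)"
      using eventually_ge_at_top [of 1]
    proof eventually_elim
      case (elim y)
      then show ?case using C [of "of_real x + \<i> * of_real y"] by simp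
    qed
  qed
  then show ?thesis
    by (simp add: LIM_zero_iff)
qed

text \<open>The system \<open>K' = K G\<close> is triangular: the derivative of a coefficient of \<open>K\<close> involves only
  coefficients at shorter words.\<close>

lemma nc_ode_decay:
  assumes K: "\<And>z. z \<in> uhp \<Longrightarrow> has_nc_derivative K (K z * G z) z"
    and G: "\<And>w. exp_growth (- 1) (\<lambda>z. nc_coeff (G z) w)" "\<And>z. nc_coeff (G z) [] = 0"
  shows "\<exists>l. exp_growth (- 1) (\<lambda>z. nc_coeff (K z) w - l)"
proof (induction "length w" arbitrary: w rule: less_induct)
  case less
  have "exp_growth (- 1) (\<lambda>z. nc_coeff (K z * G z) w)"
    unfolding nc_coeff_mult_split_right G(2) mult_zero_right add_0_right
  proof (rule exp_growth_sum)
    fix k assume "k \<in> {..<length w}"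
    then have "length (take k w) < length w"
      by auto
    \<comment> \<open>Coefficients of \<open>K\<close> at shorter words converge and so are bounded;
      times a coefficient of \<open>G\<close> they still decay.\<close>
    then obtain l where "exp_growth (- 1) (\<lambda>z. nc_coeff (K z) (take k w) - l)"
      using less by blast
    then have "exp_growth 0 (\<lambda>z. nc_coeff (K z) (take k w))"
      by (rule exp_decay_imp_bounded)
    from exp_growth_mult [OF this G(1)]
    show "exp_growth (- 1) (\<lambda>z. nc_coeff (K z) (take k w) * nc_coeff (G z) (drop k w))"
      by simp
  qed
  moreover have "((\<lambda>z. nc_coeff (K z) w) has_field_derivative nc_coeff (K z * G z) w) (at z)"
    if "z \<in> uhp" for z
    using K [OF that] by (simp add: has_nc_derivative_def)
  ultimately show ?case
    using exp_decay_primitive [of "\<lambda>z. nc_coeff (K z) w" "\<lambda>z. nc_coeff (K z * G z) w"] by blast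
qed

lemma exp_growth_nc_mult:
  assumes "\<And>w. exp_growth c (\<lambda>z. nc_coeff (F z) w)" "\<And>w. exp_growth d (\<lambda>z. nc_coeff (G z) w)"
  shows "exp_growth (c + d) (\<lambda>z. nc_coeff (F z * G z) w)"
  unfolding nc_coeff_mult by (intro exp_growth_sum exp_growth_mult assms)

section \<open>Regularized integrals to infinity\<close>

lemma open_uhp: "open uhp"
  unfolding uhp_def by (rule open_halfspace_Im_gt)

lemma convex_uhp: "convex uhp"
  unfolding uhp_def by (rule convex_halfspace_Im_gt)

lemma SL2Z_iff:
  fixes \<gamma> :: "int ^ 2 ^ 2"
  shows "\<gamma> \<in> SL2Z \<longleftrightarrow> \<gamma> $ 1 $ 1 * \<gamma> $ 2 $ 2 - \<gamma> $ 1 $ 2 * \<gamma> $ 2 $ 1 = 1"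
  by (simp add: SL2Z_def det_2)

lemma moebius_denom_nonzero:
  fixes \<gamma> :: "int ^ 2 ^ 2"
  assumes "\<gamma> \<in> SL2Z" "\<tau> \<in> uhp"
  shows "of_int (\<gamma> $ 2 $ 1) * \<tau> + of_int (\<gamma> $ 2 $ 2) \<noteq> (0 :: complex)"
proof
  assume 0: "of_int (\<gamma> $ 2 $ 1) * \<tau> + of_int (\<gamma> $ 2 $ 2) = (0 :: complex)"
  then have "Im (of_int (\<gamma> $ 2 $ 1) * \<tau> + of_int (\<gamma> $ 2 $ 2)) = 0"
    by simp
  then have "\<gamma> $ 2 $ 1 = 0"
    using assms by (simp add: uhp_def)
  with 0 assms show False
    by (simp add: SL2Z_iff)
qed

lemma moebius_in_uhp:
  fixes \<gamma> :: "int ^ 2 ^ 2"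
  assumes "\<gamma> \<in> SL2Z" "\<tau> \<in> uhp"
  shows "moebius \<gamma> \<tau> \<in> uhp"
proof -
  define a b c d where abcd: "a = \<gamma> $ 1 $ 1" "b = \<gamma> $ 1 $ 2" "c = \<gamma> $ 2 $ 1" "d = \<gamma> $ 2 $ 2"
  have "a * d - b * c = 1"
    using assms by (simp add: SL2Z_iff abcd)
  then have det: "real_of_int a * of_int d - of_int b * of_int c = 1"
    by (metis of_int_1 of_int_diff of_int_mult)
  have "Im ((of_int a * \<tau> + of_int b) / (of_int c * \<tau> + of_int d)) =
      (of_int a * of_int d - of_int b * of_int c) * Im \<tau> / (norm (of_int c * \<tau> + of_int d))\<^sup>2"
    by (simp add: Im_divide cmod_power2 algebra_simps add_divide_distrib diff_divide_distrib)
  then show ?thesis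
    using moebius_denom_nonzero [OF assms] assms(2) by (simp add: det moebius_def uhp_def flip: abcd)
qed

lemma word_weight_mshuffles:
  "w \<in># mshuffles u v \<Longrightarrow> word_weight wt w = word_weight wt u + word_weight wt v"
  by (induction u v arbitrary: w rule: mshuffles.induct) (auto simp: word_weight_def)

lemma mshuffles_nonempty: "u \<noteq> [] \<Longrightarrow> w \<in># mshuffles u v \<Longrightarrow> w \<noteq> []"
  by (drule length_in_mshuffles) auto

lemma tendsto_sum_mset:
  fixes f :: "'b \<Rightarrow> real \<Rightarrow> complex"
  assumes "\<And>x. x \<in># M \<Longrightarrow> (f x \<longlongrightarrow> l x) F"
  shows "((\<lambda>y. \<Sum>x\<in>#M. f x y) \<longlongrightarrow> (\<Sum>x\<in>#M. l x)) F"
  using assms by (induction M) (auto intro!: tendsto_add)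

section \<open>The two forms of a modular family and their growth\<close>

locale modular_family =
  fixes wt :: "'a \<Rightarrow> nat" and h :: "'a list \<Rightarrow> complex \<Rightarrow> complex"
  assumes even_wt: "\<And>a. even (wt a)" and family: "h \<in> modular_families wt"
begin

lemma modular: "B \<noteq> [] \<Longrightarrow> modular_form (word_weight wt B + 2) (h B)"
  using family by (simp add: modular_families_def)

lemma even_word_weight: "even (word_weight wt B)"
  unfolding word_weight_def by (induction B) (auto simp: even_wt)

abbreviation "\<Omega> \<equiv> Omega wt h"
abbreviation "\<Omega>i \<equiv> Omega_inf wt h"
abbreviation "I X Y \<equiv> iter_int (\<Omega> X Y)"
abbreviation "Ii X Y \<equiv> iter_int (\<Omega>i X Y)"

sublocale O: nc_form uhp "\<Omega> X Y" for X Y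
proof
  fix w
  show "(\<lambda>t. nc_coeff (\<Omega> X Y t) w) holomorphic_on uhp"
  proof (cases "w = []")
    case False
    then have "h w holomorphic_on uhp"
      using modular by (auto simp: modular_form_def)
    with False show ?thesis
      unfolding Omega_def by (auto intro!: holomorphic_intros)
  qed (simp add: Omega_def)
qed (auto simp: open_uhp convex_uhp Omega_def)

text \<open>The coefficients are polynomials in the point, so the domain is the whole plane and
  rational endpoints are allowed.\<close>

sublocale Oi: nc_form UNIV "\<Omega>i X Y" for X Y
proof
  fix w
  show "(\<lambda>t. nc_coeff (\<Omega>i X Y t) w) holomorphic_on UNIV"
    by (cases "w = []") (auto simp: Omega_inf_def intro!: holomorphic_intros)
qed (auto simp: Omega_inf_def)

lemma subexp_Omega_inf: "subexp (\<lambda>z. nc_coeff (\<Omega>i X Y z) w)"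
proof -
  have "subexp (\<lambda>z. c * (X + - Y * z) ^ n)" for c n
    by (intro subexp_mult subexp_power subexp_add subexp_const subexp_ident)
  then show ?thesis
    by (cases "w = []") (auto simp: Omega_inf_def subexp_const)
qed

text \<open>By the differential equation, the derivative of a coefficient combines coefficients at
  shorter words with polynomials.\<close>

lemma subexp_Ii_left: "subexp (\<lambda>z. nc_coeff (Ii X Y z s) w)"
proof (induction "length w" arbitrary: w rule: less_induct)
  case less
  have "subexp (\<lambda>z. nc_coeff (- (\<Omega>i X Y z * Ii X Y z s)) w)"
    unfolding nc_coeff_mult_split_left nc_coeff_uminus Oi.form_Nil mult_zero_left add_0_left
    by (intro subexp_uminus subexp_sum subexp_mult subexp_Omega_inf less) auto
  moreover have "((\<lambda>z. nc_coeff (Ii X Y z s) w) has_field_derivative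
      nc_coeff (- (\<Omega>i X Y z * Ii X Y z s)) w) (at z)" for z
    using Oi.has_nc_derivative_iter_int [of s z] by (simp add: has_nc_derivative_def)
  ultimately show ?case
    using subexp_primitive [of "\<lambda>z. nc_coeff (Ii X Y z s) w" "\<lambda>z. nc_coeff (- (\<Omega>i X Y z * Ii X Y z s)) w"]
    by blast
qed

lemma subexp_Ii_right: "subexp (\<lambda>z. nc_coeff (Ii X Y s z) w)"
proof (induction "length w" arbitrary: w rule: less_induct)
  case less
  have "subexp (\<lambda>z. nc_coeff (Ii X Y s z * \<Omega>i X Y z) w)"
    unfolding nc_coeff_mult_split_right Oi.form_Nil mult_zero_right add_0_right
    by (intro subexp_sum subexp_mult subexp_Omega_inf less) auto
  moreover have "((\<lambda>z. nc_coeff (Ii X Y s z) w) has_field_derivative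
      nc_coeff (Ii X Y s z * \<Omega>i X Y z) w) (at z)" for z
    using Oi.has_nc_derivative_iter_int_right [of s z] by (simp add: has_nc_derivative_def)
  ultimately show ?case
    using subexp_primitive [of "\<lambda>z. nc_coeff (Ii X Y s z) w" "\<lambda>z. nc_coeff (Ii X Y s z * \<Omega>i X Y z) w"]
    by blast
qed

text \<open>The Fourier tail decays at the rate \<open>2 * pi\<close>; the summand 1 pays for the
  polynomial factor.\<close>

lemma exp_growth_Omega_diff:
  "exp_growth (1 - 2 * pi) (\<lambda>z. nc_coeff (\<Omega> X Y z - \<Omega>i X Y z) w)"
proof (cases "w = []")
  case True
  then show ?thesis
    by (simp add: O.form_Nil Oi.form_Nil) (auto simp: exp_growth_def intro!: exI [of _ 0])
next
  case False
  obtain C where "\<And>\<tau>. Im \<tau> \<ge> 1 \<Longrightarrow> norm (h w \<tau> - fourier_coeff (h w) 0) \<le> C * exp (- (2 * pi * Im \<tau>))"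
    using fourier_expansion_decay [OF fourier_coeff_expansion [OF modular [OF False]]] by blast
  then have "exp_growth (- 2 * pi) (\<lambda>z. h w z - fourier_coeff (h w) 0)"
    by (auto simp: exp_growth_def)
  moreover have "subexp (\<lambda>z. (X + - Y * z) ^ n)" for n
    by (intro subexp_mult subexp_power subexp_add subexp_const subexp_ident)
  then have "exp_growth 1 (\<lambda>z. (X + - Y * z) ^ word_weight wt w)"
    by (simp add: subexp_def)
  ultimately have "exp_growth (- 2 * pi + 1)
      (\<lambda>z. (h w z - fourier_coeff (h w) 0) * (X + - Y * z) ^ word_weight wt w)"
    by (rule exp_growth_mult)
  then show ?thesis
    using False by (simp add: Omega_def Omega_inf_def left_diff_distrib)
qed

text \<open>One \<open>L\<close> serves every abscissa \<open>x\<close>, since the decay of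
  \<open>K\<close> towards its limit is uniform in half-strips.\<close>

lemma regularized_exists:
  assumes "\<tau> \<in> uhp"
  shows "\<exists>L. \<forall>w x. ((\<lambda>y. nc_coeff (I X Y \<tau> (of_real x + \<i> * of_real y) *
      Ii X Y (of_real x + \<i> * of_real y) s) w) \<longlongrightarrow> nc_coeff L w) at_top"
proof -
  define K where "K z = I X Y \<tau> z * Ii X Y z s" for z
  define G where "G z = Ii X Y s z * ((\<Omega> X Y z - \<Omega>i X Y z) * Ii X Y z s)" for z
  have "has_nc_derivative K (K z * G z) z" if "z \<in> uhp" for z
  proof -
    have "has_nc_derivative K (I X Y \<tau> z * \<Omega> X Y z * Ii X Y z s + I X Y \<tau> z * - (\<Omega>i X Y z * Ii X Y z s)) z"
      unfolding K_def
      by (intro has_nc_derivative_mult O.has_nc_derivative_iter_int_right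
          Oi.has_nc_derivative_iter_int) (use assms that in auto)
    also have "I X Y \<tau> z * \<Omega> X Y z * Ii X Y z s + I X Y \<tau> z * - (\<Omega>i X Y z * Ii X Y z s) =
        I X Y \<tau> z * ((\<Omega> X Y z - \<Omega>i X Y z) * Ii X Y z s)"
      by (simp add: algebra_simps)
    also have "\<dots> = I X Y \<tau> z * (Ii X Y z s * Ii X Y s z) * ((\<Omega> X Y z - \<Omega>i X Y z) * Ii X Y z s)"
      by (simp add: Oi.iter_int_inverse)
    also have "\<dots> = K z * G z"
      by (simp add: K_def G_def mult.assoc)
    finally show ?thesis .
  qed
  moreover have "exp_growth (- 1) (\<lambda>z. nc_coeff (G z) w)" for w
  proof (rule exp_growth_mono)
    \<comment> \<open>The outer factors of \<open>G\<close> are subexponential and are given rate 1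
      each. The total \<open>3 - 2 * pi\<close> is at most -1.\<close>
    show "exp_growth (1 + ((1 - 2 * pi) + 1)) (\<lambda>z. nc_coeff (G z) w)"
      unfolding G_def using subexp_Ii_left subexp_Ii_right
      by (intro exp_growth_nc_mult exp_growth_Omega_diff) (auto simp: subexp_def)
    show "1 + ((1 - 2 * pi) + 1) \<le> - 1"
      using pi_ge_two by simp
  qed
  moreover have "nc_coeff (G z) [] = 0" for z
    by (simp add: G_def O.form_Nil Oi.form_Nil)
  ultimately have "\<exists>l. exp_growth (- 1) (\<lambda>z. nc_coeff (K z) w - l)" for w
    by (rule nc_ode_decay)
  then obtain l where "\<And>w. exp_growth (- 1) (\<lambda>z. nc_coeff (K z) w - l w)"
    by metis
  then have "((\<lambda>y. nc_coeff (K (of_real x + \<i> * of_real y)) w) \<longlongrightarrow> nc_coeff (NC l) w) at_top" for x w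
    using exp_decay_tendsto [of "\<lambda>z. nc_coeff (K z) w" "l w"] by simp
  then show ?thesis
    unfolding K_def by blast
qed

abbreviation "to_inf \<equiv> int_to_inf wt h"

text \<open>The limit does not depend on the vertical line, which makes it compatible with translations.\<close>

lemma to_inf_tendsto:
  assumes "\<tau> \<in> uhp"
  shows "((\<lambda>y. nc_coeff (I X Y \<tau> (of_real x + \<i> * of_real y) *
      Ii X Y (of_real x + \<i> * of_real y) (of_rat s)) w) \<longlongrightarrow> nc_coeff (to_inf \<tau> (Fin s) X Y) w) at_top"
proof -
  obtain L where L: "\<And>w x. ((\<lambda>y. nc_coeff (I X Y \<tau> (of_real x + \<i> * of_real y) *
      Ii X Y (of_real x + \<i> * of_real y) (of_rat s)) w) \<longlongrightarrow> nc_coeff L w) at_top"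
    using regularized_exists [OF assms] by blast
  have "nc_coeff (to_inf \<tau> (Fin s) X Y) w = nc_coeff L w" for w
    using tendsto_Lim [OF _ L [of 0 w]] by (simp add: int_to_inf_def)
  then show ?thesis
    using L by simp
qed

lemma uhp_ii: "y > 0 \<Longrightarrow> of_real x + \<i> * of_real y \<in> uhp"
  by (simp add: uhp_def)

section \<open>Changes of endpoint, of base point and of coordinates\<close>

lemma to_inf_Nil:
  assumes "\<tau> \<in> uhp"
  shows "nc_coeff (to_inf \<tau> (Fin s) X Y) [] = 1"
proof -
  have "((\<lambda>y. nc_coeff (I X Y \<tau> (of_real 0 + \<i> * of_real y) *
      Ii X Y (of_real 0 + \<i> * of_real y) (of_rat s)) []) \<longlongrightarrow> 1) at_top"
    by (simp add: O.iter_int_Nil Oi.iter_int_Nil)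
  from tendsto_unique [OF trivial_limit_at_top_linorder to_inf_tendsto [OF assms] this]
  show ?thesis .
qed

text \<open>Composition of paths holds before the limit once \<open>y > 0\<close>, and coefficients
  of a product are finite sums, so it passes to the limit.\<close>

lemma to_inf_trans:
  assumes "\<tau> \<in> uhp" "\<tau>' \<in> uhp"
  shows "to_inf \<tau> (Fin s) X Y = I X Y \<tau> \<tau>' * to_inf \<tau>' (Fin s) X Y"
proof (rule ncps_eqI)
  fix w
  let ?K = "\<lambda>\<tau> y. I X Y \<tau> (of_real 0 + \<i> * of_real y) * Ii X Y (of_real 0 + \<i> * of_real y) (of_rat s)"
  have "((\<lambda>y. nc_coeff (I X Y \<tau> \<tau>' * ?K \<tau>' y) w) \<longlongrightarrow>
      nc_coeff (I X Y \<tau> \<tau>' * to_inf \<tau>' (Fin s) X Y) w) at_top"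
    unfolding nc_coeff_mult [of "I X Y \<tau> \<tau>'"] by (intro tendsto_intros to_inf_tendsto assms)
  moreover have "\<forall>\<^sub>F y in at_top. nc_coeff (I X Y \<tau> \<tau>' * ?K \<tau>' y) w = nc_coeff (?K \<tau> y) w"
    using eventually_gt_at_top [of 0]
  proof eventually_elim
    case (elim y)
    then show ?case
      using O.iter_int_trans [OF assms uhp_ii [of y 0]] by (simp add: mult.assoc [symmetric])
  qed
  ultimately have "((\<lambda>y. nc_coeff (?K \<tau> y) w) \<longlongrightarrow> nc_coeff (I X Y \<tau> \<tau>' * to_inf \<tau>' (Fin s) X Y) w) at_top"
    by (rule Lim_transform_eventually)
  with to_inf_tendsto [OF assms(1), of X Y 0 s w]
  show "nc_coeff (to_inf \<tau> (Fin s) X Y) w = nc_coeff (I X Y \<tau> \<tau>' * to_inf \<tau>' (Fin s) X Y) w"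
    by (intro tendsto_unique [OF trivial_limit_at_top_linorder])
qed

text \<open>The correction involves only \<open>\<Omega>i\<close>. It is the source of the middle
  factor in the factorization of \<open>F\<close>.\<close>

lemma to_inf_base:
  assumes "\<tau> \<in> uhp"
  shows "to_inf \<tau> (Fin s') X Y = to_inf \<tau> (Fin s) X Y * Ii X Y (of_rat s) (of_rat s')"
proof (rule ncps_eqI)
  fix w
  let ?K = "\<lambda>s y. I X Y \<tau> (of_real 0 + \<i> * of_real y) * Ii X Y (of_real 0 + \<i> * of_real y) (of_rat s)"
  let ?J = "Ii X Y (of_rat s) (of_rat s')"
  have "((\<lambda>y. nc_coeff (?K s y * ?J) w) \<longlongrightarrow> nc_coeff (to_inf \<tau> (Fin s) X Y * ?J) w) at_top"
    unfolding nc_coeff_mult [of _ ?J] by (intro tendsto_intros to_inf_tendsto assms)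
  moreover have "?K s y * ?J = ?K s' y" for y
    by (simp add: mult.assoc Oi.iter_int_trans)
  ultimately have "((\<lambda>y. nc_coeff (?K s' y) w) \<longlongrightarrow> nc_coeff (to_inf \<tau> (Fin s) X Y * ?J) w) at_top"
    by simp
  with to_inf_tendsto [OF assms(1), of X Y 0 s' w]
  show "nc_coeff (to_inf \<tau> (Fin s') X Y) w = nc_coeff (to_inf \<tau> (Fin s) X Y * ?J) w"
    by (intro tendsto_unique [OF trivial_limit_at_top_linorder])
qed

text \<open>All word weights are even, so neither form changes.\<close>

lemma to_inf_uminus: "to_inf \<tau> (Fin s) (- X) (- Y) = to_inf \<tau> (Fin s) X Y"
proof -
  have "(- X + Y * t) ^ word_weight wt B = (X - Y * t) ^ word_weight wt B" for t B
    using power_minus_even [OF even_word_weight, of "X - Y * t"] by simp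
  then have "\<Omega> (- X) (- Y) = \<Omega> X Y" "\<Omega>i (- X) (- Y) = \<Omega>i X Y"
    by (auto simp: Omega_def Omega_inf_def fun_eq_iff intro!: arg_cong [where f = NC])
  then show ?thesis
    by (simp add: int_to_inf_def)
qed

text \<open>With \<open>j\<close> the automorphy factor and \<open>n\<close> the weight of the word,
  \<open>h\<close> contributes \<open>j ^ (n + 2)\<close>, the linear form to the power
  \<open>n\<close> contributes \<open>j\<close> to the power \<open>- n\<close>, and the
  differential contributes the inverse square of \<open>j\<close>. So the form is invariant and the
  pullback lemma applies.\<close>

lemma I_moebius:
  fixes \<gamma> :: "int ^ 2 ^ 2"
  assumes \<gamma>: "\<gamma> \<in> SL2Z" and \<tau>: "\<tau> \<in> uhp" "\<tau>' \<in> uhp"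
  shows "slash (\<lambda>X Y. I X Y (moebius \<gamma> \<tau>) (moebius \<gamma> \<tau>')) \<gamma> X Y = I X Y \<tau> \<tau>'"
proof -
  define a b c d where abcd: "a = \<gamma> $ 1 $ 1" "b = \<gamma> $ 1 $ 2" "c = \<gamma> $ 2 $ 1" "d = \<gamma> $ 2 $ 2"
  have "a * d - b * c = 1"
    using \<gamma> by (simp add: SL2Z_iff abcd)
  then have det_complex: "complex_of_int a * of_int d - of_int b * of_int c = 1"
    by (metis of_int_1 of_int_diff of_int_mult)
  have m: "moebius \<gamma> t = (of_int a * t + of_int b) / (of_int c * t + of_int d)" for t
    by (simp add: moebius_def abcd)
  have nz: "of_int c * t + of_int d \<noteq> (0 :: complex)" if "t \<in> uhp" for t
    using moebius_denom_nonzero [OF \<gamma> that] by (simp add: abcd)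
  have "I (of_int a * X + of_int b * Y) (of_int c * X + of_int d * Y) (moebius \<gamma> \<tau>) (moebius \<gamma> \<tau>') = I X Y \<tau> \<tau>'"
  proof (rule O.iter_int_pullback [where \<phi>' = "\<lambda>t. 1 / (of_int c * t + of_int d)\<^sup>2"])
    show "nc_form uhp (\<Omega> (of_int a * X + of_int b * Y) (of_int c * X + of_int d * Y))"
      by unfold_locales
    fix t assume t: "t \<in> uhp"
    have "(moebius \<gamma> has_field_derivative
       (of_int a * (of_int c * t + of_int d) - (of_int a * t + of_int b) * of_int c) /
       ((of_int c * t + of_int d) * (of_int c * t + of_int d))) (at t)"
      unfolding m [abs_def] using nz [OF t] by (auto intro!: derivative_eq_intros)
    also have "of_int a * (of_int c * t + of_int d) - (of_int a * t + of_int b) * of_int c =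
        complex_of_int a * of_int d - of_int b * of_int c"
      by (simp add: algebra_simps)
    finally show "(moebius \<gamma> has_field_derivative 1 / (of_int c * t + of_int d)\<^sup>2) (at t)"
      by (simp add: det_complex power2_eq_square)
    fix w
    show "nc_coeff (\<Omega> (of_int a * X + of_int b * Y) (of_int c * X + of_int d * Y) (moebius \<gamma> t)) w *
        (1 / (of_int c * t + of_int d)\<^sup>2) = nc_coeff (\<Omega> X Y t) w"
    proof (cases "w = []")
      case True
      then show ?thesis by (simp add: Omega_def)
    next
      case False
      let ?j = "of_int c * t + of_int d" and ?n = "word_weight wt w"
      have "h w (moebius \<gamma> t) = ?j ^ (?n + 2) * h w t"
        using modular [OF False] \<gamma> t by (simp add: modular_form_def abcd)
      moreover have "of_int a * X + of_int b * Y - (of_int c * X + of_int d * Y) * moebius \<gamma> t =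
          (X - Y * t) / ?j"
      proof -
        have "(of_int a * X + of_int b * Y - (of_int c * X + of_int d * Y) * moebius \<gamma> t) * ?j =
          (of_int a * X + of_int b * Y) * ?j - (of_int c * X + of_int d * Y) * (of_int a * t + of_int b)"
          using nz [OF t] by (simp add: m left_diff_distrib)
        also have "\<dots> = (complex_of_int a * of_int d - of_int b * of_int c) * (X - Y * t)"
          by (simp add: algebra_simps)
        finally show ?thesis
          using nz [OF t] by (simp add: det_complex eq_divide_eq)
      qed
      ultimately show ?thesis
        using nz [OF t] False by (simp add: Omega_def power_divide power_add power2_eq_square)
    qed
  qed (use \<tau> \<gamma> moebius_in_uhp in auto)
  then show "slash (\<lambda>X Y. I X Y (moebius \<gamma> \<tau>) (moebius \<gamma> \<tau>')) \<gamma> X Y = I X Y \<tau> \<tau>'"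
    by (simp add: slash_def abcd)
qed

lemma Ii_translate:
  "Ii (X + c * Y) Y (\<tau> + c) (\<tau>' + c) = Ii X Y \<tau> \<tau>'"
proof (rule Oi.iter_int_pullback [where \<phi>' = "\<lambda>t. 1" and \<phi> = "\<lambda>t. t + c"])
  show "nc_form UNIV (\<Omega>i (X + c * Y) Y)"
    by unfold_locales
  have eq: "X + c * Y - Y * (t + c) = X - Y * t" for t
    by (simp add: algebra_simps)
  show "nc_coeff (\<Omega>i (X + c * Y) Y (t + c)) w * 1 = nc_coeff (\<Omega>i X Y t) w" for t w
    unfolding Omega_inf_def eq by simp
qed (auto intro!: derivative_eq_intros)

text \<open>Translation by \<open>n\<close> carries the vertical line with real part
  \<open>- n\<close> to the imaginary axis, and the limit is the same along both lines.\<close>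

lemma to_inf_translate:
  assumes "\<tau> \<in> uhp"
  shows "to_inf (\<tau> + of_int n) (Fin (s + of_int n)) (X + of_int n * Y) Y = to_inf \<tau> (Fin s) X Y"
proof (rule ncps_eqI)
  fix w
  define \<gamma> :: "int ^ 2 ^ 2" where "\<gamma> = vector [vector [1, n], vector [0, 1]]"
  have \<gamma>: "\<gamma> \<in> SL2Z"
    by (simp add: \<gamma>_def SL2Z_def det_2)
  have m: "moebius \<gamma> t = t + of_int n" for t
    by (simp add: moebius_def \<gamma>_def)
  let ?K = "\<lambda>y. I (X + of_int n * Y) Y (\<tau> + of_int n) (of_real 0 + \<i> * of_real y) *
      Ii (X + of_int n * Y) Y (of_real 0 + \<i> * of_real y) (of_rat (s + of_int n))"
  let ?K' = "\<lambda>y. I X Y \<tau> (of_real (- of_int n) + \<i> * of_real y) *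
      Ii X Y (of_real (- of_int n) + \<i> * of_real y) (of_rat s)"
  have K_eq: "?K' y = ?K y" if "y > 0" for y
  proof -
    have "I (X + of_int n * Y) Y (\<tau> + of_int n) (of_real (- of_int n) + \<i> * of_real y + of_int n) =
        I X Y \<tau> (of_real (- of_int n) + \<i> * of_real y)"
      using I_moebius [OF \<gamma> assms uhp_ii [OF that, of "- of_int n"], of X Y]
      unfolding m by (simp add: slash_def \<gamma>_def)
    moreover have "Ii (X + of_int n * Y) Y (of_real (- of_int n) + \<i> * of_real y + of_int n) (of_rat s + of_int n) =
        Ii X Y (of_real (- of_int n) + \<i> * of_real y) (of_rat s)"
      by (rule Ii_translate)
    moreover have "of_real (- of_int n) + \<i> * of_real y + of_int n = of_real 0 + \<i> * of_real y"
      by simp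
    ultimately show ?thesis
      by (simp only: of_rat_add of_rat_of_int_eq)
  qed
  have "\<forall>\<^sub>F y in at_top. nc_coeff (?K' y) w = nc_coeff (?K y) w"
    by (intro eventually_mono [OF eventually_gt_at_top [of "0 :: real"]]) (simp only: K_eq)
  from Lim_transform_eventually [OF to_inf_tendsto [OF assms] this]
  have "((\<lambda>y. nc_coeff (?K y) w) \<longlongrightarrow> nc_coeff (to_inf \<tau> (Fin s) X Y) w) at_top" .
  moreover have "((\<lambda>y. nc_coeff (?K y) w) \<longlongrightarrow>
      nc_coeff (to_inf (\<tau> + of_int n) (Fin (s + of_int n)) (X + of_int n * Y) Y) w) at_top"
    by (rule to_inf_tendsto) (use assms in \<open>simp add: uhp_def\<close>)
  ultimately show "nc_coeff (to_inf (\<tau> + of_int n) (Fin (s + of_int n)) (X + of_int n * Y) Y) w =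
      nc_coeff (to_inf \<tau> (Fin s) X Y) w"
    by (intro tendsto_unique [OF trivial_limit_at_top_linorder])
qed

section \<open>Shuffle relations for regularized integrals\<close>

lemma fourier_coeff_tendsto:
  assumes "B \<noteq> []"
  shows "((\<lambda>y. h B (\<i> * of_real y)) \<longlongrightarrow> fourier_coeff (h B) 0) at_top"
proof -
  obtain C where C: "\<And>\<tau>. Im \<tau> \<ge> 1 \<Longrightarrow> norm (h B \<tau> - fourier_coeff (h B) 0) \<le> C * exp (- (2 * pi * Im \<tau>))"
    using fourier_expansion_decay [OF fourier_coeff_expansion [OF modular [OF assms]]] by blast
  have "((\<lambda>y. C * exp (- (2 * pi * y))) \<longlongrightarrow> 0) at_top"
    by real_asymp
  then have "((\<lambda>y. h B (\<i> * of_real y) - fourier_coeff (h B) 0) \<longlongrightarrow> 0) at_top"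
  proof (rule Lim_null_comparison [rotated])
    show "\<forall>\<^sub>F y in at_top. norm (h B (\<i> * of_real y) - fourier_coeff (h B) 0) \<le> C * exp (- (2 * pi * y))"
      using eventually_ge_at_top [of 1]
    proof eventually_elim
      case (elim y)
      then show ?case using C [of "\<i> * of_real y"] by simp
    qed
  qed
  then show ?thesis
    by (simp add: LIM_zero_iff)
qed

text \<open>All shuffles of \<open>u\<close> and \<open>v\<close> have the same weight, so the power
  of \<open>z\<close> factors out.\<close>

lemma nc_shuffle_weighted:
  assumes "u \<noteq> []"
  shows "nc_shuffle (NC (\<lambda>B. if B = [] then 0 else g B * z ^ word_weight wt B)) u v =
    (\<Sum>w\<in>#mshuffles u v. g w) * z ^ (word_weight wt u + word_weight wt v)"
  unfolding nc_shuffle_def sum_mset_distrib_right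
  by (intro arg_cong [where f = sum_mset] image_mset_cong)
     (auto simp: word_weight_mshuffles dest: mshuffles_nonempty [OF assms])

lemma lie_Omega:
  assumes "lie_family h" "t \<in> uhp"
  shows "nc_lie (\<Omega> X Y t)"
  using assms unfolding nc_lie_def Omega_def lie_family_def
  by (auto simp: nc_shuffle_weighted)

text \<open>The Lie condition on \<open>h\<close> passes to the constant coefficients, which are the
  limits of \<open>h\<close> up the imaginary axis.\<close>

lemma lie_Omega_inf:
  assumes "lie_family h"
  shows "nc_lie (\<Omega>i X Y t)"
proof -
  have "(\<Sum>w\<in>#mshuffles u v. fourier_coeff (h w) 0) = 0" if "u \<noteq> []" "v \<noteq> []" for u v
  proof -
    have "((\<lambda>y. \<Sum>w\<in>#mshuffles u v. h w (\<i> * of_real y)) \<longlongrightarrow>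
        (\<Sum>w\<in>#mshuffles u v. fourier_coeff (h w) 0)) at_top"
      by (intro tendsto_sum_mset fourier_coeff_tendsto mshuffles_nonempty [OF that(1)])
    moreover have "\<forall>\<^sub>F y in at_top. (\<Sum>w\<in>#mshuffles u v. h w (\<i> * of_real y)) = 0"
      using eventually_gt_at_top [of 0]
    proof eventually_elim
      case (elim y)
      then show ?case
        using assms that by (auto simp: lie_family_def uhp_def)
    qed
    ultimately have "((\<lambda>y::real. 0) \<longlongrightarrow> (\<Sum>w\<in>#mshuffles u v. fourier_coeff (h w) 0)) at_top"
      by (rule Lim_transform_eventually)
    from tendsto_unique [OF trivial_limit_at_top_linorder this tendsto_const] show ?thesis .
  qed
  then show ?thesis
    unfolding nc_lie_def Omega_inf_def by (auto simp: nc_shuffle_weighted)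
qed

text \<open>Each shuffle relation is a polynomial identity in finitely many coefficients and
  therefore survives the limit.\<close>

lemma grouplike_to_inf:
  assumes "lie_family h" "\<tau> \<in> uhp"
  shows "grouplike (to_inf \<tau> (Fin s) X Y)"
  unfolding grouplike_def
proof (intro allI)
  fix u v
  let ?K = "\<lambda>y. I X Y \<tau> (of_real 0 + \<i> * of_real y) * Ii X Y (of_real 0 + \<i> * of_real y) (of_rat s)"
  have "\<forall>\<^sub>F y in at_top. nc_coeff (?K y) u * nc_coeff (?K y) v = nc_shuffle (?K y) u v"
    using eventually_gt_at_top [of "0 :: real"]
  proof eventually_elim
    case (elim y)
    have "grouplike (I X Y \<tau> (of_real 0 + \<i> * of_real y))"
      by (rule O.grouplike_iter_int [OF lie_Omega [OF assms(1)] assms(2) uhp_ii [OF elim]])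
    moreover have "grouplike (Ii X Y (of_real 0 + \<i> * of_real y) (of_rat s))"
      by (rule Oi.grouplike_iter_int [OF lie_Omega_inf [OF assms(1)] UNIV_I UNIV_I])
    ultimately have "grouplike (?K y)"
      by (rule grouplike_mult)
    then show ?case
      by (simp add: grouplike_def)
  qed
  moreover have "((\<lambda>y. nc_coeff (?K y) u * nc_coeff (?K y) v) \<longlongrightarrow>
      nc_coeff (to_inf \<tau> (Fin s) X Y) u * nc_coeff (to_inf \<tau> (Fin s) X Y) v) at_top"
    by (intro tendsto_mult to_inf_tendsto assms)
  ultimately have "((\<lambda>y. nc_shuffle (?K y) u v) \<longlongrightarrow>
      nc_coeff (to_inf \<tau> (Fin s) X Y) u * nc_coeff (to_inf \<tau> (Fin s) X Y) v) at_top"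
    by (rule Lim_transform_eventually [rotated])
  moreover have "((\<lambda>y. nc_shuffle (?K y) u v) \<longlongrightarrow> nc_shuffle (to_inf \<tau> (Fin s) X Y) u v) at_top"
    unfolding nc_shuffle_def by (intro tendsto_sum_mset to_inf_tendsto assms)
  ultimately show "nc_coeff (to_inf \<tau> (Fin s) X Y) u * nc_coeff (to_inf \<tau> (Fin s) X Y) v =
      nc_shuffle (to_inf \<tau> (Fin s) X Y) u v"
    by (rule tendsto_unique [OF trivial_limit_at_top_linorder])
qed

end

section \<open>Integrals between tangential base points\<close>

definition mat2 :: "int \<Rightarrow> int \<Rightarrow> int \<Rightarrow> int \<Rightarrow> int ^ 2 ^ 2" where
  "mat2 a b c d = vector [vector [a, b], vector [c, d]]"

lemma mat2_nth [simp]: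
  "mat2 a b c d $ 1 $ 1 = a" "mat2 a b c d $ 1 $ 2 = b"
  "mat2 a b c d $ 2 $ 1 = c" "mat2 a b c d $ 2 $ 2 = d"
  by (simp_all add: mat2_def)

lemma matrix2_eq_iff:
  fixes A B :: "int ^ 2 ^ 2"
  shows "A = B \<longleftrightarrow> A $ 1 $ 1 = B $ 1 $ 1 \<and> A $ 1 $ 2 = B $ 1 $ 2 \<and>
    A $ 2 $ 1 = B $ 2 $ 1 \<and> A $ 2 $ 2 = B $ 2 $ 2"
  by (auto simp: vec_eq_iff forall_2)

lemma matrix2_mult_nth [simp]:
  fixes A B :: "int ^ 2 ^ 2"
  shows "(A ** B) $ i $ j = A $ i $ 1 * B $ 1 $ j + A $ i $ 2 * B $ 2 $ j"
  by (simp add: matrix_matrix_mult_def sum_2)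

lemma matrix2_one_nth [simp]:
  "(mat 1 :: int ^ 2 ^ 2) $ 1 $ 1 = 1" "(mat 1 :: int ^ 2 ^ 2) $ 1 $ 2 = 0"
  "(mat 1 :: int ^ 2 ^ 2) $ 2 $ 1 = 0" "(mat 1 :: int ^ 2 ^ 2) $ 2 $ 2 = 1"
  by (simp_all add: mat_def)

lemma SL2Z_mult: "A \<in> SL2Z \<Longrightarrow> B \<in> SL2Z \<Longrightarrow> A ** B \<in> SL2Z"
  by (simp add: SL2Z_def det_mul)

lemma SL2Z_inverse:
  fixes \<gamma> :: "int ^ 2 ^ 2"
  assumes "\<gamma> \<in> SL2Z"
  shows "matrix_inv \<gamma> \<in> SL2Z" "\<gamma> ** matrix_inv \<gamma> = mat 1" "matrix_inv \<gamma> ** \<gamma> = mat 1"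
proof -
  \<comment> \<open>The adjugate witnesses that an inverse exists, as the choice in
    \<open>matrix_inv\<close> requires.\<close>
  let ?\<delta> = "mat2 (\<gamma> $ 2 $ 2) (- \<gamma> $ 1 $ 2) (- \<gamma> $ 2 $ 1) (\<gamma> $ 1 $ 1)"
  have "\<gamma> ** ?\<delta> = mat 1 \<and> ?\<delta> ** \<gamma> = mat 1"
    using assms by (auto simp: matrix2_eq_iff SL2Z_iff algebra_simps)
  then have *: "\<gamma> ** matrix_inv \<gamma> = mat 1 \<and> matrix_inv \<gamma> ** \<gamma> = mat 1"
    unfolding matrix_inv_def by (rule someI)
  then show "\<gamma> ** matrix_inv \<gamma> = mat 1" "matrix_inv \<gamma> ** \<gamma> = mat 1"
    by auto
  have "det \<gamma> * det (matrix_inv \<gamma>) = 1"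
    using * by (metis det_mul det_I)
  then show "matrix_inv \<gamma> \<in> SL2Z"
    using assms by (simp add: SL2Z_def)
qed

lemma moebius_mult:
  fixes A B :: "int ^ 2 ^ 2"
  assumes "B \<in> SL2Z" "\<tau> \<in> uhp"
  shows "moebius (A ** B) \<tau> = moebius A (moebius B \<tau>)"
proof -
  define j where "j = of_int (B $ 2 $ 1) * \<tau> + of_int (B $ 2 $ 2)"
  define x where "x = of_int (B $ 1 $ 1) * \<tau> + of_int (B $ 1 $ 2)"
  have j: "j \<noteq> 0"
    unfolding j_def by (rule moebius_denom_nonzero [OF assms])
  have "moebius (A ** B) \<tau> = (of_int (A $ 1 $ 1) * x + of_int (A $ 1 $ 2) * j) /
      (of_int (A $ 2 $ 1) * x + of_int (A $ 2 $ 2) * j)"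
    by (simp add: moebius_def x_def j_def algebra_simps)
  also have "\<dots> = ((of_int (A $ 1 $ 1) * x + of_int (A $ 1 $ 2) * j) / j) /
      ((of_int (A $ 2 $ 1) * x + of_int (A $ 2 $ 2) * j) / j)"
    using j by simp
  also have "\<dots> = moebius A (x / j)"
    using j by (simp add: moebius_def add_divide_distrib)
  finally show ?thesis
    by (simp add: moebius_def x_def j_def)
qed

lemma slash_mult: "slash P (A ** B) = slash (slash P A) B"
  by (simp add: slash_def fun_eq_iff algebra_simps)

text \<open>The cusp with homogeneous coordinates \<open>x : y\<close>.\<close>

definition cusp_of :: "rat \<Rightarrow> rat \<Rightarrow> cusp" where
  "cusp_of x y = (if y = 0 then Infty else Fin (x / y))"

lemma cusp_of_cases:
  obtains x y where "s = cusp_of x y" "x \<noteq> 0 \<or> y \<noteq> 0"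
proof (cases s)
  case Infty
  then show ?thesis using that [of 1 0] by (simp add: cusp_of_def)
next
  case (Fin t)
  then show ?thesis using that [of t 1] by (simp add: cusp_of_def)
qed

lemma cusp_moebius_cusp_of:
  fixes \<gamma> :: "int ^ 2 ^ 2"
  assumes "x \<noteq> 0 \<or> y \<noteq> 0"
  shows "cusp_moebius \<gamma> (cusp_of x y) =
    cusp_of (of_int (\<gamma> $ 1 $ 1) * x + of_int (\<gamma> $ 1 $ 2) * y)
      (of_int (\<gamma> $ 2 $ 1) * x + of_int (\<gamma> $ 2 $ 2) * y)"
proof (cases "y = 0")
  case True
  then show ?thesis
    using assms by (simp add: cusp_moebius_def cusp_of_def)
next
  case False
  let ?n = "of_int (\<gamma> $ 1 $ 1) * x + of_int (\<gamma> $ 1 $ 2) * y"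
  let ?d = "of_int (\<gamma> $ 2 $ 1) * x + of_int (\<gamma> $ 2 $ 2) * y"
  have n: "of_int (\<gamma> $ 1 $ 1) * (x / y) + of_int (\<gamma> $ 1 $ 2) = ?n / y"
    and d: "of_int (\<gamma> $ 2 $ 1) * (x / y) + of_int (\<gamma> $ 2 $ 2) = ?d / y"
    using False by (simp_all add: add_divide_distrib)
  show ?thesis
    using False unfolding cusp_moebius_def cusp_of_def
    by (simp only: cusp.case Let_def n d if_False) (simp add: False)
qed

text \<open>In homogeneous coordinates the action is linear. What has to be checked is that
  \<open>B\<close> does not send a non-zero vector to 0, and Cramer's rule with determinant 1 shows
  this.\<close>

lemma cusp_moebius_mult:
  fixes A B :: "int ^ 2 ^ 2"
  assumes "B \<in> SL2Z"
  shows "cusp_moebius (A ** B) s = cusp_moebius A (cusp_moebius B s)"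
proof -
  obtain x y where s: "s = cusp_of x y" and xy: "x \<noteq> 0 \<or> y \<noteq> 0"
    by (rule cusp_of_cases)
  define x' where "x' = of_int (B $ 1 $ 1) * x + of_int (B $ 1 $ 2) * y"
  define y' where "y' = of_int (B $ 2 $ 1) * x + of_int (B $ 2 $ 2) * y"
  have det: "rat_of_int (B $ 1 $ 1) * of_int (B $ 2 $ 2) - of_int (B $ 1 $ 2) * of_int (B $ 2 $ 1) = 1"
    using assms unfolding SL2Z_iff by (metis of_int_1 of_int_diff of_int_mult)
  have "of_int (B $ 2 $ 2) * x' - of_int (B $ 1 $ 2) * y' = x *
      (rat_of_int (B $ 1 $ 1) * of_int (B $ 2 $ 2) - of_int (B $ 1 $ 2) * of_int (B $ 2 $ 1))"
    by (simp add: x'_def y'_def algebra_simps)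
  moreover have "of_int (B $ 1 $ 1) * y' - of_int (B $ 2 $ 1) * x' = y *
      (rat_of_int (B $ 1 $ 1) * of_int (B $ 2 $ 2) - of_int (B $ 1 $ 2) * of_int (B $ 2 $ 1))"
    by (simp add: x'_def y'_def algebra_simps)
  ultimately have "x' \<noteq> 0 \<or> y' \<noteq> 0"
    using xy unfolding det by auto
  then show ?thesis
    using xy unfolding s
    by (simp add: cusp_moebius_cusp_of flip: x'_def y'_def) (simp add: x'_def y'_def algebra_simps)
qed

lemma cusp_moebius_one [simp]: "cusp_moebius (mat 1) s = s"
  by (cases s) (simp_all add: cusp_moebius_def)

lemma one_SL2Z: "mat 1 \<in> SL2Z"
  by (simp add: SL2Z_iff)

lemma cusp_moebius_inverse:
  assumes "\<gamma> \<in> SL2Z"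
  shows "cusp_moebius (matrix_inv \<gamma>) (cusp_moebius \<gamma> s) = s"
    and "cusp_moebius \<gamma> (cusp_moebius (matrix_inv \<gamma>) s) = s"
  using assms by (simp_all add: SL2Z_inverse cusp_moebius_mult [symmetric])

lemma cusp_moebius_inj:
  assumes "\<gamma> \<in> SL2Z" "cusp_moebius \<gamma> s = cusp_moebius \<gamma> r"
  shows "s = r"
  using cusp_moebius_inverse(1) [OF assms(1)] assms(2) by metis

text \<open>For the cusp \<open>q / p\<close> in lowest terms, Bezout coefficients complete the
  bottom row \<open>(- p, q)\<close>, whose linear form vanishes at the cusp, to determinant
  1.\<close>

lemma cusp_to_Infty_exists: "\<exists>\<sigma>\<in>SL2Z. cusp_moebius \<sigma> r = Infty"
proof (cases r)
  case Infty
  then show ?thesis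
    using one_SL2Z by (intro bexI [of _ "mat 1"]) auto
next
  case (Fin t)
  obtain q p where t: "t = of_int q / of_int p" "p > 0" "coprime q p"
    by (metis quotient_of_coprime quotient_of_denom_pos quotient_of_div surj_pair)
  obtain u v where "u * q + v * p = 1"
    using t(3) by (metis bezout_int coprime_iff_gcd_eq_1)
  then have "mat2 u v (- p) q \<in> SL2Z"
    by (simp add: SL2Z_iff algebra_simps)
  moreover have "cusp_moebius (mat2 u v (- p) q) r = Infty"
    using t(2) by (simp add: Fin t(1) cusp_moebius_def)
  ultimately show ?thesis by blast
qed

section \<open>Transport of regularized integrals to the cusp infinity\<close>

context modular_family
begin

text \<open>For \<open>\<sigma>\<close> taking a cusp \<open>r\<close> to infinity, this is the
  integral from \<open>\<tau>\<close> to the base point \<open>s\<close> at \<open>r\<close>,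
  computed at infinity and pulled back.\<close>

definition via_inf :: "int ^ 2 ^ 2 \<Rightarrow> complex \<Rightarrow> cusp \<Rightarrow> complex \<Rightarrow> complex \<Rightarrow> 'a ncps" where
  "via_inf \<sigma> \<tau> s = slash (to_inf (moebius \<sigma> \<tau>) (cusp_moebius \<sigma> s)) \<sigma>"

lemma via_inf_mult:
  assumes "\<gamma> \<in> SL2Z" "\<tau> \<in> uhp"
  shows "via_inf (\<sigma> ** \<gamma>) \<tau> s = slash (via_inf \<sigma> (moebius \<gamma> \<tau>) (cusp_moebius \<gamma> s)) \<gamma>"
  using assms by (simp add: via_inf_def slash_mult moebius_mult cusp_moebius_mult)

text \<open>Up to sign the stabilizer of infinity consists of translations;
  \<open>to_inf_translate\<close> handles these and \<open>to_inf_uminus\<close> the sign.\<close>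

lemma via_inf_fix_Infty:
  fixes N :: "int ^ 2 ^ 2"
  assumes N: "N \<in> SL2Z" "cusp_moebius N Infty = Infty" and "\<tau> \<in> uhp" "s \<noteq> Infty"
  shows "via_inf N \<tau> s = to_inf \<tau> s"
proof -
  obtain t where s: "s = Fin t"
    using assms by (cases s) auto
  define e n where "e = N $ 1 $ 1" "n = N $ 1 $ 2"
  have c: "N $ 2 $ 1 = 0"
    using N(2) by (simp add: cusp_moebius_def split: if_splits)
  then have "e * N $ 2 $ 2 = 1"
    using N(1) by (simp add: SL2Z_iff e_n_def)
  then have ed: "e = N $ 2 $ 2" "e = 1 \<or> e = - 1"
    by (auto simp: zmult_eq_1_iff)
  then have m: "moebius N \<tau> = \<tau> + of_int (e * n)" "cusp_moebius N (Fin t) = Fin (t + of_int (e * n))"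
    using c by (auto simp: moebius_def cusp_moebius_def s e_n_def Let_def add_divide_distrib)
  have "to_inf (\<tau> + of_int (e * n)) (Fin (t + of_int (e * n))) (of_int e * X + of_int n * Y) (of_int e * Y) =
      to_inf \<tau> (Fin t) X Y" for X Y
    using ed(2)
  proof
    assume "e = 1"
    then show ?thesis
      using to_inf_translate [OF assms(3), of n t X Y] by simp
  next
    assume e: "e = - 1"
    have "to_inf (\<tau> + of_int (- n)) (Fin (t + of_int (- n))) (- (X + of_int (- n) * Y)) (- Y) =
      to_inf \<tau> (Fin t) X Y"
      unfolding to_inf_uminus by (rule to_inf_translate [OF assms(3)])
    then show ?thesis
      by (simp add: e)
  qed
  then show ?thesis
    by (simp add: via_inf_def m slash_def c ed(1) [symmetric] s fun_eq_iff flip: e_n_def)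
qed

text \<open>Two matrices taking \<open>r\<close> to infinity differ by an element of the stabilizer
  of infinity. \<open>s \<noteq> r\<close> ensures that the transported base point is
  finite.\<close>

lemma via_inf_unique:
  assumes \<sigma>: "\<sigma> \<in> SL2Z" "cusp_moebius \<sigma> r = Infty" "\<sigma>' \<in> SL2Z" "cusp_moebius \<sigma>' r = Infty"
    and "\<tau> \<in> uhp" "s \<noteq> r"
  shows "via_inf \<sigma>' \<tau> s = via_inf \<sigma> \<tau> s"
proof -
  define N where "N = \<sigma>' ** matrix_inv \<sigma>"
  have N: "N \<in> SL2Z"
    unfolding N_def by (intro SL2Z_mult SL2Z_inverse \<sigma>)
  have \<sigma>': "\<sigma>' = N ** \<sigma>"
    using \<sigma> by (simp add: N_def matrix_mul_assoc [symmetric] SL2Z_inverse)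
  have "cusp_moebius N Infty = Infty"
    using \<sigma> \<sigma>' by (metis cusp_moebius_mult)
  moreover have "cusp_moebius \<sigma> s \<noteq> Infty"
    using \<sigma> assms cusp_moebius_inj by metis
  ultimately have "via_inf N (moebius \<sigma> \<tau>) (cusp_moebius \<sigma> s) = to_inf (moebius \<sigma> \<tau>) (cusp_moebius \<sigma> s)"
    using N \<sigma> assms by (intro via_inf_fix_Infty moebius_in_uhp) auto
  then show ?thesis
    unfolding \<sigma>' via_inf_mult [OF \<sigma>(1) \<open>\<tau> \<in> uhp\<close>] by (simp add: via_inf_def)
qed

lemma via_inf_eq_to_inf:
  assumes "\<sigma> \<in> SL2Z" "cusp_moebius \<sigma> r = Infty" "s \<noteq> r"
  obtains t where "via_inf \<sigma> \<tau> s = slash (to_inf (moebius \<sigma> \<tau>) (Fin t)) \<sigma>" "cusp_moebius \<sigma> s = Fin t"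
proof (cases "cusp_moebius \<sigma> s")
  case Infty
  then show ?thesis
    using assms cusp_moebius_inj by metis
next
  case (Fin t)
  then show ?thesis
    using that by (simp add: via_inf_def)
qed

lemma via_inf_Nil:
  assumes "\<sigma> \<in> SL2Z" "cusp_moebius \<sigma> r = Infty" "s \<noteq> r" "\<tau> \<in> uhp"
  shows "nc_coeff (via_inf \<sigma> \<tau> s X Y) [] = 1"
  using via_inf_eq_to_inf [OF assms(1-3), of \<tau>] to_inf_Nil [OF moebius_in_uhp [OF assms(1,4)]]
  by (metis slash_def)

text \<open>The definite description ranges over \<open>\<gamma>\<close> with
  \<open>\<gamma>(\<infinity>) = r\<close>, whose inverses take \<open>r\<close> to infinity. All of
  them give one value by \<open>via_inf_unique\<close>, and the inverse of \<open>\<sigma>\<close>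
  shows that at least one exists.\<close>

lemma tan_eq_via_inf:
  assumes "\<sigma> \<in> SL2Z" "cusp_moebius \<sigma> r = Infty" "s \<noteq> r" "\<tau> \<in> uhp"
  shows int_to_tan_eq: "int_to_tan wt h \<tau> s r X Y = via_inf \<sigma> \<tau> s X Y"
    and int_from_tan_eq: "int_from_tan wt h s r \<tau> X Y = nc_inverse (via_inf \<sigma> \<tau> s X Y)"
proof -
  have "int_from_tan wt h s r \<tau> X Y = nc_inverse (via_inf \<sigma> \<tau> s X Y) \<and>
    int_to_tan wt h \<tau> s r X Y = via_inf \<sigma> \<tau> s X Y"
  proof (cases r)
    case Infty
    have "via_inf \<sigma> \<tau> s = to_inf \<tau> s"
      using assms Infty by (intro via_inf_fix_Infty) auto
    then show ?thesis
      by (simp add: int_from_tan_def int_to_tan_def int_from_inf_def Infty)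
  next
    case (Fin t)
    let ?J = "\<lambda>X Y. nc_inverse (via_inf \<sigma> \<tau> s X Y)"
    have eq: "slash (int_from_inf wt h (cusp_moebius (matrix_inv \<gamma>) s) (moebius (matrix_inv \<gamma>) \<tau>))
              (matrix_inv \<gamma>) = ?J" if "\<gamma> \<in> SL2Z" "cusp_moebius \<gamma> Infty = r" for \<gamma>
    proof -
      have "cusp_moebius (matrix_inv \<gamma>) r = Infty"
        using that cusp_moebius_inverse by metis
      then have "via_inf (matrix_inv \<gamma>) \<tau> s = via_inf \<sigma> \<tau> s"
        using that assms SL2Z_inverse by (intro via_inf_unique) auto
      then show ?thesis
        by (simp add: via_inf_def slash_def int_from_inf_def fun_eq_iff)
    qed
    have \<sigma>: "matrix_inv \<sigma> \<in> SL2Z" "cusp_moebius (matrix_inv \<sigma>) Infty = r"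
      using assms SL2Z_inverse cusp_moebius_inverse by metis+
    have "int_from_tan wt h s r \<tau> = ?J"
      unfolding int_from_tan_def Fin cusp.case
    proof (rule the_equality)
      show "\<forall>\<gamma>\<in>SL2Z. cusp_moebius \<gamma> Infty = Fin t \<longrightarrow> ?J =
          slash (int_from_inf wt h (cusp_moebius (matrix_inv \<gamma>) s) (moebius (matrix_inv \<gamma>) \<tau>)) (matrix_inv \<gamma>)"
        using eq Fin by simp
    next
      fix J
      assume "\<forall>\<gamma>\<in>SL2Z. cusp_moebius \<gamma> Infty = Fin t \<longrightarrow> J =
          slash (int_from_inf wt h (cusp_moebius (matrix_inv \<gamma>) s) (moebius (matrix_inv \<gamma>) \<tau>)) (matrix_inv \<gamma>)"
      then show "J = ?J"
        using \<sigma> eq Fin by blast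
    qed
    then show ?thesis
      by (simp add: int_to_tan_def Fin nc_inverse_inverse via_inf_Nil [OF assms])
  qed
  then show "int_to_tan wt h \<tau> s r X Y = via_inf \<sigma> \<tau> s X Y"
    "int_from_tan wt h s r \<tau> X Y = nc_inverse (via_inf \<sigma> \<tau> s X Y)"
    by auto
qed

section \<open>Composition and equivariance of integrals between base points\<close>

abbreviation "to_tan \<equiv> int_to_tan wt h"
abbreviation "tan_tan \<equiv> int_tan_tan wt h"

lemma int_from_tan_eq_inverse:
  assumes "s \<noteq> r" "\<tau> \<in> uhp"
  shows "int_from_tan wt h s r \<tau> X Y = nc_inverse (to_tan \<tau> s r X Y)"
  using cusp_to_Infty_exists [of r] tan_eq_via_inf assms by metis

lemma to_tan_Nil:
  assumes "s \<noteq> r" "\<tau> \<in> uhp"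
  shows "nc_coeff (to_tan \<tau> s r X Y) [] = 1"
  using cusp_to_Infty_exists [of r] tan_eq_via_inf via_inf_Nil assms by metis

lemma to_tan_trans:
  assumes "s \<noteq> r" "\<tau> \<in> uhp" "\<tau>' \<in> uhp"
  shows "to_tan \<tau> s r X Y = I X Y \<tau> \<tau>' * to_tan \<tau>' s r X Y"
proof -
  obtain \<sigma> where \<sigma>: "\<sigma> \<in> SL2Z" "cusp_moebius \<sigma> r = Infty"
    using cusp_to_Infty_exists by blast
  obtain t where t: "cusp_moebius \<sigma> s = Fin t"
    using via_inf_eq_to_inf [OF \<sigma> assms(1)] by metis
  have "via_inf \<sigma> \<tau> s X Y = slash (\<lambda>X Y. I X Y (moebius \<sigma> \<tau>) (moebius \<sigma> \<tau>')) \<sigma> X Y * via_inf \<sigma> \<tau>' s X Y"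
    unfolding via_inf_def t slash_def using \<sigma> assms by (intro to_inf_trans moebius_in_uhp)
  then show ?thesis
    using assms \<sigma> by (simp add: int_to_tan_eq [OF \<sigma>] I_moebius)
qed

text \<open>Moving \<open>\<tau>\<close> inserts an integral between the two points and its inverse,
  which cancel. Hence the definite description has a value and any \<open>\<tau>\<close> computes
  it.\<close>

lemma tan_tan_eq:
  assumes "s \<noteq> r" "s' \<noteq> r'" "\<tau> \<in> uhp"
  shows "tan_tan s r s' r' X Y = nc_inverse (to_tan \<tau> s r X Y) * to_tan \<tau> s' r' X Y"
proof -
  let ?J = "\<lambda>\<tau> X Y. nc_inverse (to_tan \<tau> s r X Y) * to_tan \<tau> s' r' X Y"
  have J: "?J \<tau>' = ?J \<tau>" if "\<tau>' \<in> uhp" for \<tau>'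
  proof (intro ext)
    fix X Y
    have "?J \<tau>' X Y = nc_inverse (to_tan \<tau> s r X Y) * (nc_inverse (I X Y \<tau>' \<tau>) * I X Y \<tau>' \<tau>) * to_tan \<tau> s' r' X Y"
      using assms that
      by (simp add: to_tan_trans [of _ _ \<tau>' \<tau>] nc_inverse_mult to_tan_Nil O.iter_int_Nil mult.assoc)
    then show "?J \<tau>' X Y = ?J \<tau> X Y"
      by (simp add: nc_left_inverse O.iter_int_Nil)
  qed
  have "int_tan_tan wt h s r s' r' = ?J \<tau>"
    unfolding int_tan_tan_def
  proof (rule the_equality)
    show "\<forall>\<tau>'\<in>uhp. ?J \<tau> = (\<lambda>X Y. int_from_tan wt h s r \<tau>' X Y * int_to_tan wt h \<tau>' s' r' X Y)"
    proof
      fix \<tau>' assume "\<tau>' \<in> uhp"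
      then show "?J \<tau> = (\<lambda>X Y. int_from_tan wt h s r \<tau>' X Y * int_to_tan wt h \<tau>' s' r' X Y)"
        unfolding int_from_tan_eq_inverse [OF assms(1) \<open>\<tau>' \<in> uhp\<close>] by (rule J [symmetric])
    qed
  next
    fix J
    assume "\<forall>\<tau>'\<in>uhp. J = (\<lambda>X Y. int_from_tan wt h s r \<tau>' X Y * int_to_tan wt h \<tau>' s' r' X Y)"
    from bspec [OF this assms(3)] show "J = ?J \<tau>"
      unfolding int_from_tan_eq_inverse [OF assms(1,3)] .
  qed
  then show ?thesis by simp
qed

lemma ii_in_uhp: "\<i> \<in> uhp"
  by (simp add: uhp_def)

lemma tan_tan_Nil:
  assumes "s \<noteq> r" "s' \<noteq> r'"
  shows "nc_coeff (tan_tan s r s' r' X Y) [] = 1"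
  using assms by (simp add: tan_tan_eq [OF _ _ ii_in_uhp] nc_coeff_inverse_Nil to_tan_Nil ii_in_uhp)

lemma tan_tan_trans:
  assumes "s \<noteq> r" "s' \<noteq> r'" "s'' \<noteq> r''"
  shows "tan_tan s r s' r' X Y * tan_tan s' r' s'' r'' X Y = tan_tan s r s'' r'' X Y"
proof -
  let ?T = "\<lambda>s r. to_tan \<i> s r X Y"
  have "tan_tan s r s' r' X Y * tan_tan s' r' s'' r'' X Y =
      nc_inverse (?T s r) * (?T s' r' * nc_inverse (?T s' r')) * ?T s'' r''"
    using assms by (simp add: tan_tan_eq [OF _ _ ii_in_uhp] mult.assoc)
  also have "?T s' r' * nc_inverse (?T s' r') = 1"
    using assms by (intro nc_right_inverse to_tan_Nil ii_in_uhp)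
  finally show ?thesis
    using assms by (simp add: tan_tan_eq [OF _ _ ii_in_uhp])
qed

lemma tan_tan_refl:
  assumes "s \<noteq> r"
  shows "tan_tan s r s r X Y = 1"
  using assms by (simp add: tan_tan_eq [OF _ _ ii_in_uhp] nc_left_inverse to_tan_Nil ii_in_uhp)

lemma tan_tan_inverse:
  assumes "s \<noteq> r" "s' \<noteq> r'"
  shows "nc_inverse (tan_tan s r s' r' X Y) = tan_tan s' r' s r X Y"
  using assms by (intro nc_inverse_unique) (simp_all add: tan_tan_trans tan_tan_refl)

text \<open>If \<open>\<sigma>\<close> takes \<open>\<gamma>(r)\<close> to infinity, then
  \<open>\<sigma> ** \<gamma>\<close> takes \<open>r\<close> there, so both sides can be computed at
  infinity.\<close>

lemma to_tan_moebius:
  assumes "\<gamma> \<in> SL2Z" "s \<noteq> r" "\<tau> \<in> uhp"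
  shows "slash (to_tan (moebius \<gamma> \<tau>) (cusp_moebius \<gamma> s) (cusp_moebius \<gamma> r)) \<gamma> X Y = to_tan \<tau> s r X Y"
proof -
  obtain \<sigma> where \<sigma>: "\<sigma> \<in> SL2Z" "cusp_moebius \<sigma> (cusp_moebius \<gamma> r) = Infty"
    using cusp_to_Infty_exists by blast
  have "cusp_moebius \<gamma> s \<noteq> cusp_moebius \<gamma> r"
    using assms cusp_moebius_inj by blast
  then have "slash (to_tan (moebius \<gamma> \<tau>) (cusp_moebius \<gamma> s) (cusp_moebius \<gamma> r)) \<gamma> X Y =
      slash (via_inf \<sigma> (moebius \<gamma> \<tau>) (cusp_moebius \<gamma> s)) \<gamma> X Y"
    unfolding slash_def using assms \<sigma> by (intro int_to_tan_eq moebius_in_uhp)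
  also have "\<dots> = via_inf (\<sigma> ** \<gamma>) \<tau> s X Y"
    using assms by (simp add: via_inf_mult)
  also have "\<dots> = to_tan \<tau> s r X Y"
    using assms \<sigma> by (intro int_to_tan_eq [symmetric] SL2Z_mult) (auto simp: cusp_moebius_mult)
  finally show ?thesis .
qed

lemma tan_tan_moebius:
  assumes "\<gamma> \<in> SL2Z" "s \<noteq> r" "s' \<noteq> r'"
  shows "slash (tan_tan (cusp_moebius \<gamma> s) (cusp_moebius \<gamma> r) (cusp_moebius \<gamma> s') (cusp_moebius \<gamma> r')) \<gamma> X Y =
    tan_tan s r s' r' X Y"
proof -
  have "cusp_moebius \<gamma> s \<noteq> cusp_moebius \<gamma> r" "cusp_moebius \<gamma> s' \<noteq> cusp_moebius \<gamma> r'"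
    using assms cusp_moebius_inj by blast+
  from tan_tan_eq [OF this moebius_in_uhp [OF assms(1) ii_in_uhp]] show ?thesis
    using assms to_tan_moebius [OF assms(1) assms(2) ii_in_uhp, of X Y]
      to_tan_moebius [OF assms(1) assms(3) ii_in_uhp, of X Y]
    by (simp add: slash_def tan_tan_eq [OF _ _ ii_in_uhp])
qed

text \<open>Equivariance under the matrix -1, which fixes every cusp.\<close>

lemma tan_tan_uminus:
  assumes "s \<noteq> r" "s' \<noteq> r'"
  shows "tan_tan s r s' r' (- X) (- Y) = tan_tan s r s' r' X Y"
proof -
  define \<gamma> where "\<gamma> = mat2 (- 1) 0 0 (- 1)"
  have "\<gamma> \<in> SL2Z" "cusp_moebius \<gamma> s = s" for s
    by (auto simp: \<gamma>_def SL2Z_iff cusp_moebius_def split: cusp.split)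
  from tan_tan_moebius [OF this(1) assms, of X Y] show ?thesis
    by (simp add: \<open>\<And>s. cusp_moebius \<gamma> s = s\<close>) (simp add: slash_def \<gamma>_def)
qed

text \<open>Between two base points at one cusp the part depending on \<open>\<tau>\<close> cancels,
  and only the change of base point at infinity remains.\<close>

lemma tan_tan_same_cusp:
  assumes "\<sigma> \<in> SL2Z" "cusp_moebius \<sigma> r = Infty" "cusp_moebius \<sigma> s = Fin t" "cusp_moebius \<sigma> s' = Fin t'"
  shows "tan_tan s r s' r X Y = slash (\<lambda>X Y. Ii X Y (of_rat t) (of_rat t')) \<sigma> X Y"
proof -
  have ne: "s \<noteq> r" "s' \<noteq> r"
    using assms by auto
  have "via_inf \<sigma> \<i> s' X Y = via_inf \<sigma> \<i> s X Y * slash (\<lambda>X Y. Ii X Y (of_rat t) (of_rat t')) \<sigma> X Y"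
    unfolding via_inf_def assms slash_def
    by (intro to_inf_base moebius_in_uhp assms ii_in_uhp)
  then show ?thesis
    using ne by (simp add: tan_tan_eq [OF _ _ ii_in_uhp] int_to_tan_eq [OF assms(1,2) _ ii_in_uhp]
        mult.assoc [symmetric] nc_left_inverse via_inf_Nil [OF assms(1,2) _ ii_in_uhp])
qed

lemma grouplike_tan_tan:
  assumes "lie_family h" "s \<noteq> r" "s' \<noteq> r'"
  shows "grouplike (tan_tan s r s' r' X Y)"
proof -
  have "grouplike (to_tan \<i> s r X Y)" if sr: "s \<noteq> r" for s r
  proof -
    obtain \<sigma> where \<sigma>: "\<sigma> \<in> SL2Z" "cusp_moebius \<sigma> r = Infty"
      using cusp_to_Infty_exists by blast
    obtain t where t: "cusp_moebius \<sigma> s = Fin t"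
      using via_inf_eq_to_inf [OF \<sigma> sr] by metis
    show ?thesis
      unfolding int_to_tan_eq [OF \<sigma> sr ii_in_uhp] via_inf_def t slash_def
      by (intro grouplike_to_inf moebius_in_uhp assms ii_in_uhp \<sigma>)
  qed
  then show ?thesis
    using assms by (simp add: tan_tan_eq [OF _ _ ii_in_uhp] grouplike_mult grouplike_inverse
        to_tan_Nil ii_in_uhp)
qed

end

section \<open>Dedekind symbols and reciprocity functions\<close>

lemma has_field_derivative_divided_power:
  "((\<lambda>t. (b - t) ^ Suc n / fact (Suc n)) has_field_derivative - ((b - t) ^ n / fact n)) (at (t :: complex))"
proof -
  have "((\<lambda>t. b - t) has_field_derivative - 1) (at t)"
    by (auto intro!: derivative_eq_intros)
  from DERIV_cdivide [OF DERIV_power_Suc [OF this, of n], of "fact (Suc n)"]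
  have "((\<lambda>t. (b - t) ^ Suc n / fact (Suc n)) has_field_derivative
      (1 + of_nat n) * (- 1 * (b - t) ^ n) / fact (Suc n)) (at t)" .
  moreover have "1 + of_nat n \<noteq> (0 :: complex)"
    using of_nat_neq_0 [of n, where 'a = complex] by simp
  then have "(1 + of_nat n) * (- 1 * (b - t) ^ n) / fact (Suc n) = - ((b - t) ^ n / fact n)"
    by (simp add: divide_simps)
  ultimately show ?thesis
    by (simp only:)
qed

context modular_family
begin

abbreviation "letter_constant x \<equiv> fourier_coeff (h [x]) 0"

text \<open>At \<open>X = 1\<close>, \<open>Y = 0\<close> the form is constant, and by hypothesis it
  is supported on letters. The solution of the differential equation is then an exponential.\<close>

lemma Ii_1_0:
  assumes "letter_constant_terms h"
  shows "Ii 1 0 a b = letter_exp letter_constant (b - a)"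
proof (rule nc_ode_unique [where \<Omega> = "\<Omega>i 1 0" and S = UNIV and a = b and F = "\<lambda>t. Ii 1 0 t b"
      and G = "\<lambda>t. letter_exp letter_constant (b - t)"])
  fix t
  show "has_nc_derivative (\<lambda>t. letter_exp letter_constant (b - t))
      (- (\<Omega>i 1 0 t * letter_exp letter_constant (b - t))) t"
    unfolding has_nc_derivative_def
  proof
    fix w
    show "((\<lambda>t. nc_coeff (letter_exp letter_constant (b - t)) w) has_field_derivative
        nc_coeff (- (\<Omega>i 1 0 t * letter_exp letter_constant (b - t))) w) (at t)"
    proof (cases w)
      case Nil
      then show ?thesis
        by (simp add: nc_coeff_letter_exp Oi.form_Nil)
    next
      case (Cons x xs)
      let ?P = "\<Prod>y\<leftarrow>xs. letter_constant y"
      have "nc_coeff (\<Omega>i 1 0 t * letter_exp letter_constant (b - t)) w =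
          (\<Sum>k\<in>{1}. nc_coeff (\<Omega>i 1 0 t) (take k w) * nc_coeff (letter_exp letter_constant (b - t)) (drop k w))"
        unfolding nc_coeff_mult_split_left Oi.form_Nil mult_zero_left add_0_left
        by (rule sum.mono_neutral_right)
           (use assms in \<open>auto simp: Cons Omega_inf_def letter_constant_terms_def\<close>)
      also have "\<dots> = (b - t) ^ length xs / fact (length xs) * (letter_constant x * ?P)"
        by (simp add: Cons Omega_inf_def nc_coeff_letter_exp)
      finally have eq: "nc_coeff (- (\<Omega>i 1 0 t * letter_exp letter_constant (b - t))) w =
          - ((b - t) ^ length xs / fact (length xs)) * (letter_constant x * ?P)"
        by simp
      show ?thesis
        unfolding eq unfolding nc_coeff_letter_exp Cons
        using DERIV_cmult_right [OF has_field_derivative_divided_power, of b "length xs" "letter_constant x * ?P" t]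
        by (simp add: mult_ac)
    qed
  qed
qed (auto simp: Oi.iter_int_refl letter_exp_0 Oi.form_Nil intro: Oi.has_nc_derivative_iter_int)

end

lemma reciprocity_E_eq:
  "reciprocity_E h p q = letter_exp (\<lambda>x. fourier_coeff (h [x]) 0) (1 / of_int (p * q))"
proof -
  have "(\<lambda>w. if length w = 1 then fourier_coeff (h w) 0 / of_int (p * q) else 0) =
    (\<lambda>w. if length w = 1 then 1 / of_int (p * q) * fourier_coeff (h [hd w]) 0 else (0 :: complex))"
    by (auto simp: fun_eq_iff length_Suc_conv)
  then show ?thesis
    unfolding reciprocity_E_def letter_exp_def by (simp only:)
qed

lemma U'_iff: "(p, q) \<in> U' \<longleftrightarrow> gcd p q = 1 \<and> p \<noteq> 0 \<and> q \<noteq> 0"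
  by (auto simp: U'_def)

text \<open>Since exponents add, the three-term relation is the partial fraction identity
  \<open>1/(p q) = 1/(p (p + q)) + 1/((p + q) q)\<close>, and the inversion relation is the oddness
  of \<open>1/(p q)\<close>.\<close>

lemma reciprocity_E_function: "almost_multiple_reciprocity_function (reciprocity_E h)"
proof -
  have "reciprocity_E h p q = reciprocity_E h p (p + q) * reciprocity_E h (p + q) q"
    if "(p, q) \<in> U'" "p + q \<noteq> 0" for p q
  proof -
    have "of_int (p + q) \<noteq> (0 :: complex)"
      using that by (simp only: of_int_eq_0_iff) simp
    then have "1 / of_int (p * q) = 1 / of_int (p * (p + q)) + (1 / of_int ((p + q) * q) :: complex)"
      using that by (simp add: U'_iff divide_simps)
    then show ?thesis
      unfolding reciprocity_E_eq by (simp only: letter_exp_add)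
  qed
  moreover have "reciprocity_E h p q * reciprocity_E h (- q) p = 1" for p q
    unfolding reciprocity_E_eq letter_exp_add [symmetric]
    by (simp add: letter_exp_0 mult.commute)
  moreover have "nc_coeff (reciprocity_E h p q) [] = 1" for p q
    by (simp add: reciprocity_E_eq nc_coeff_letter_exp)
  moreover have "reciprocity_E h p (- q) = reciprocity_E h (- p) q" for p q
    by (simp add: reciprocity_E_eq)
  ultimately show ?thesis
    unfolding almost_multiple_reciprocity_function_def by blast
qed

lemma shuffled_iff: "shuffled D \<longleftrightarrow> (\<forall>(p, q)\<in>U'. grouplike (D p q))"
  by (simp add: shuffled_def grouplike_def nc_shuffle_def)

section \<open>The functional equations of \<open>D\<close> and \<open>F\<close> and the
  factorization\<close>

context modular_family
begin

lemma dedekind_D_eq: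
  "dedekind_D wt h p q = tan_tan (Fin (of_int q / of_int p)) Infty Infty (Fin (of_int q / of_int p)) (of_int q) (of_int p)"
  by (simp add: dedekind_D_def Let_def)

lemma reciprocity_F_eq:
  "reciprocity_F wt h p q = tan_tan (Fin (of_int q / of_int p)) Infty (Fin (of_int q / of_int p)) (Fin 0) (of_int q) (of_int p)"
  by (simp add: reciprocity_F_def Let_def)

lemma dedekind_D_symbol: "almost_multiple_dedekind_symbol (dedekind_D wt h)"
proof -
  have "dedekind_D wt h p q = dedekind_D wt h p (p + q)" if "(p, q) \<in> U'" for p q
  proof -
    \<comment> \<open>This translation fixes infinity, takes \<open>q / p\<close> to
      \<open>(p + q) / p\<close> and the point \<open>(X, Y) = (q, p)\<close> to
      \<open>(p + q, p)\<close>.\<close>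
    let ?\<gamma> = "mat2 1 1 0 1" and ?s = "Fin (of_int q / of_int p)"
    have \<gamma>: "?\<gamma> \<in> SL2Z" "cusp_moebius ?\<gamma> Infty = Infty"
      "cusp_moebius ?\<gamma> ?s = Fin (of_int (p + q) / of_int p)"
      using that by (simp_all add: SL2Z_iff cusp_moebius_def U'_iff add_divide_distrib)
    show ?thesis
      using tan_tan_moebius [OF \<gamma>(1), of ?s Infty Infty ?s "of_int q" "of_int p"]
      unfolding \<gamma> dedekind_D_eq by (simp add: slash_def add.commute)
  qed
  moreover have "dedekind_D wt h p (- q) = dedekind_D wt h (- p) q" for p q
    unfolding dedekind_D_eq
    using tan_tan_uminus [of "Fin (- (of_int q / of_int p))" Infty Infty "Fin (- (of_int q / of_int p))" "of_int q" "- of_int p"]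
    by simp
  moreover have "nc_coeff (dedekind_D wt h p q) [] = 1" for p q
    unfolding dedekind_D_eq by (rule tan_tan_Nil) auto
  ultimately show ?thesis
    unfolding almost_multiple_dedekind_symbol_def by blast
qed

lemma reciprocity_F_function: "almost_multiple_reciprocity_function (reciprocity_F wt h)"
proof -
  have "reciprocity_F wt h p q = reciprocity_F wt h p (p + q) * reciprocity_F wt h (p + q) q"
    if pq: "(p, q) \<in> U'" "p + q \<noteq> 0" for p q
  proof -
    \<comment> \<open>The path from infinity to 0 is cut at the cusp -1. \<open>?\<gamma>\<close>
      takes the first half, and \<open>?\<delta>\<close> the second, to a path from infinity to 0;
      they send \<open>(q, p)\<close> to \<open>(p + q, p)\<close> and
      \<open>(q, p + q)\<close>.\<close>
    let ?\<gamma> = "mat2 1 1 0 1" and ?\<delta> = "mat2 1 0 1 1" and ?s = "Fin (of_int q / of_int p)"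
    have nz: "rat_of_int (p + q) \<noteq> 0"
      using pq by (simp only: of_int_eq_0_iff) simp
    have \<gamma>: "?\<gamma> \<in> SL2Z" "cusp_moebius ?\<gamma> Infty = Infty"
      "cusp_moebius ?\<gamma> ?s = Fin (of_int (p + q) / of_int p)" "cusp_moebius ?\<gamma> (Fin (- 1)) = Fin 0"
      using pq by (simp_all add: SL2Z_iff cusp_moebius_def U'_iff add_divide_distrib)
    have "1 + of_int q / of_int p = (of_int (p + q) / of_int p :: rat)"
      using pq by (simp add: add_divide_distrib U'_iff)
    then have \<delta>: "?\<delta> \<in> SL2Z" "cusp_moebius ?\<delta> (Fin (- 1)) = Infty" "cusp_moebius ?\<delta> (Fin 0) = Fin 0"
      "cusp_moebius ?\<delta> ?s = Fin (of_int q / of_int (p + q))"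
      using pq nz by (simp_all add: SL2Z_iff cusp_moebius_def U'_iff add.commute del: of_int_add)
    have s: "?s \<noteq> Fin (- 1)" "?s \<noteq> Fin 0"
      using pq nz by (auto simp: U'_iff divide_eq_eq add_eq_0_iff)
    have "reciprocity_F wt h p (p + q) = tan_tan ?s Infty ?s (Fin (- 1)) (of_int q) (of_int p)"
      using tan_tan_moebius [OF \<gamma>(1), of ?s Infty ?s "Fin (- 1)" "of_int q" "of_int p"] s
      unfolding \<gamma> reciprocity_F_eq by (simp add: slash_def add.commute)
    moreover have "reciprocity_F wt h (p + q) q = tan_tan ?s (Fin (- 1)) ?s (Fin 0) (of_int q) (of_int p)"
      using tan_tan_moebius [OF \<delta>(1), of ?s "Fin (- 1)" ?s "Fin 0" "of_int q" "of_int p"] s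
      unfolding \<delta> reciprocity_F_eq by (simp add: slash_def add.commute)
    ultimately show ?thesis
      using s by (simp add: tan_tan_trans reciprocity_F_eq)
  qed
  moreover have "reciprocity_F wt h p q * reciprocity_F wt h (- q) p = 1" if pq: "(p, q) \<in> U'" for p q
  proof -
    \<comment> \<open>This matrix exchanges 0 and infinity and so reverses the path. It sends
      \<open>(q, p)\<close> to \<open>(- p, q)\<close>, the negative of the point at which
      \<open>F(- q, p)\<close> is evaluated.\<close>
    let ?\<gamma> = "mat2 0 (- 1) 1 0" and ?s = "Fin (of_int q / of_int p)"
    have \<gamma>: "?\<gamma> \<in> SL2Z" "cusp_moebius ?\<gamma> Infty = Fin 0" "cusp_moebius ?\<gamma> (Fin 0) = Infty"
      "cusp_moebius ?\<gamma> ?s = Fin (of_int p / of_int (- q))"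
      using pq by (simp_all add: SL2Z_iff cusp_moebius_def U'_iff)
    have s: "?s \<noteq> Fin 0" "Fin (of_int p / of_int (- q)) \<noteq> Fin 0"
      using pq by (auto simp: U'_iff)
    have "reciprocity_F wt h (- q) p = tan_tan ?s (Fin 0) ?s Infty (of_int q) (of_int p)"
      using tan_tan_moebius [OF \<gamma>(1), of ?s "Fin 0" ?s Infty "of_int q" "of_int p"] s(1)
        tan_tan_uminus [OF _ s(2), of "Fin (of_int p / of_int (- q))" Infty "of_int p" "of_int (- q)"]
      unfolding \<gamma> reciprocity_F_eq by (simp add: slash_def)
    then show ?thesis
      using s by (simp add: tan_tan_trans tan_tan_refl reciprocity_F_eq)
  qed
  moreover have "reciprocity_F wt h p (- q) = reciprocity_F wt h (- p) q" if "(p, q) \<in> U'" for p q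
    unfolding reciprocity_F_eq using that
      tan_tan_uminus [of "Fin (- (of_int q / of_int p))" Infty "Fin (- (of_int q / of_int p))" "Fin 0" "of_int q" "- of_int p"]
    by (simp add: U'_iff)
  moreover have "nc_coeff (reciprocity_F wt h p q) [] = 1" if "(p, q) \<in> U'" for p q
    unfolding reciprocity_F_eq using that by (intro tan_tan_Nil) (auto simp: U'_iff)
  ultimately show ?thesis
    unfolding almost_multiple_reciprocity_function_def by blast
qed

text \<open>With \<open>s = q / p\<close>, the path is cut at the base points infinity and 0 of the
  cusp \<open>s\<close>. The first piece is \<open>D(p, q)\<close>, and the last is the reverse of
  the image of \<open>D(- q, p)\<close> under the exchange of 0 and infinity.\<close>

lemma reciprocity_F_factorization:
  assumes "letter_constant_terms h" and pq: "(p, q) \<in> U'"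
  shows "reciprocity_F wt h p q =
    dedekind_D wt h p q * reciprocity_E h p q * nc_inverse (dedekind_D wt h (- q) p)"
proof -
  let ?s = "Fin (of_int q / of_int p)"
  let ?T = "\<lambda>s r s' r'. tan_tan s r s' r' (of_int q) (of_int p)"
  have nz: "p \<noteq> 0" "q \<noteq> 0"
    using pq by (auto simp: U'_iff)
  have s: "?s \<noteq> Fin 0"
    using nz by simp
  have "dedekind_D wt h (- q) p = ?T ?s (Fin 0) (Fin 0) ?s"
  proof -
    let ?\<gamma> = "mat2 0 (- 1) 1 0"
    have \<gamma>: "?\<gamma> \<in> SL2Z" "cusp_moebius ?\<gamma> (Fin 0) = Infty"
      "cusp_moebius ?\<gamma> ?s = Fin (of_int p / of_int (- q))"
      using nz by (simp_all add: SL2Z_iff cusp_moebius_def)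
    show ?thesis
      using tan_tan_moebius [OF \<gamma>(1), of ?s "Fin 0" "Fin 0" ?s "of_int q" "of_int p"] s
        tan_tan_uminus [of "Fin (of_int p / of_int (- q))" Infty Infty "Fin (of_int p / of_int (- q))"
          "of_int p" "of_int (- q)"]
      unfolding \<gamma> dedekind_D_eq by (simp add: slash_def)
  qed
  then have D: "nc_inverse (dedekind_D wt h (- q) p) = ?T (Fin 0) ?s ?s (Fin 0)"
    using s by (metis tan_tan_inverse)
  have E: "?T Infty ?s (Fin 0) ?s = reciprocity_E h p q"
  proof -
    \<comment> \<open>Bezout coefficients make \<open>\<sigma>\<close> send the cusp
      \<open>s\<close> to infinity and the point \<open>(q, p)\<close> to \<open>(1, 0)\<close>. The
      base points infinity and 0 become \<open>- d / p\<close> and \<open>b / q\<close>, whose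
      difference is \<open>(d q + b p) / (p q) = 1 / (p q)\<close>.\<close>
    obtain d b where "d * q + b * p = 1"
      using pq by (metis U'_iff bezout_int gcd.commute)
    then have bd: "d * q - (- b) * p = 1"
      by simp
    define \<sigma> where "\<sigma> = mat2 d b (- p) q"
    have \<sigma>: "\<sigma> \<in> SL2Z" "cusp_moebius \<sigma> ?s = Infty" "cusp_moebius \<sigma> Infty = Fin (of_int d / of_int (- p))"
      "cusp_moebius \<sigma> (Fin 0) = Fin (of_int b / of_int q)"
      using nz bd by (simp_all add: \<sigma>_def SL2Z_iff cusp_moebius_def)
    have XY: "of_int d * of_int q + of_int b * of_int p = (1 :: complex)"
      using bd by (metis \<open>d * q + b * p = 1\<close> of_int_1 of_int_add of_int_mult)
    have "?T Infty ?s (Fin 0) ?s = Ii 1 0 (of_rat (of_int d / of_int (- p))) (of_rat (of_int b / of_int q))"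
      unfolding tan_tan_same_cusp [OF \<sigma>] by (simp add: slash_def \<sigma>_def XY)
    also have "\<dots> = letter_exp letter_constant (of_rat (of_int b / of_int q) - of_rat (of_int d / of_int (- p)))"
      by (rule Ii_1_0 [OF assms(1)])
    also have "of_rat (of_int b / of_int q) - of_rat (of_int d / of_int (- p)) = (1 / of_int (p * q) :: complex)"
      using nz XY by (simp add: of_rat_divide of_rat_minus field_simps)
    finally show ?thesis
      by (simp add: reciprocity_E_eq)
  qed
  have "reciprocity_F wt h p q = ?T ?s Infty Infty ?s * ?T Infty ?s (Fin 0) ?s * ?T (Fin 0) ?s ?s (Fin 0)"
    using s by (simp add: tan_tan_trans reciprocity_F_eq)
  then show ?thesis
    by (simp only: D E dedekind_D_eq [of p q])
qed

end

theorem theorem5p5: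
  fixes wt :: "'a::countable \<Rightarrow> nat"
    and h :: "'a list \<Rightarrow> complex \<Rightarrow> complex"
  assumes "\<And>a. even (wt a) \<and> wt a \<ge> 2"
    and "h \<in> modular_families wt"
  shows "almost_multiple_dedekind_symbol (dedekind_D wt h) \<and>
    almost_multiple_reciprocity_function (reciprocity_E h) \<and>
    almost_multiple_reciprocity_function (reciprocity_F wt h) \<and>
    shuffled (reciprocity_E h) \<and>
    (lie_family h \<longrightarrow> shuffled (dedekind_D wt h) \<and> shuffled (reciprocity_F wt h)) \<and>
    (letter_constant_terms h \<longrightarrow>
       (\<forall>(p, q)\<in>U'. reciprocity_F wt h p q =
          dedekind_D wt h p q * reciprocity_E h p q * nc_inverse (dedekind_D wt h (- q) p)))"
proof -
  interpret modular_family wt h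
    using assms by unfold_locales auto
  have "shuffled (reciprocity_E h)"
    by (simp add: shuffled_iff reciprocity_E_eq grouplike_letter_exp)
  moreover have "shuffled (dedekind_D wt h)" "shuffled (reciprocity_F wt h)" if "lie_family h"
    using that by (auto simp: shuffled_iff dedekind_D_eq reciprocity_F_eq U'_iff intro!: grouplike_tan_tan)
  ultimately show ?thesis
    using dedekind_D_symbol reciprocity_E_function reciprocity_F_function reciprocity_F_factorization
    by blast
qed

end
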